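(* Let $\ell\geq 0$. If $\Delta$ is a $(d-1)$-dimensional flag homology sphere (over a field $\mathbb{K}$) with $2d+\ell$ vertices, then $\gamma_2\leq\binom{\ell}{2}$. Moreover, $\gamma_2=\binom{\ell}{2}$ holds if and only if $\Delta\cong\Sigma^m *^{\ell}C_5$ for some $m\geq 0$.
   Context: A simplicial complex is a finite family of subsets (faces) of a finite vertex set, closed under subsets, with every vertex a face; pure of dimension $d-1$ if all maximal faces have $d$ elements. Link: $\mathrm{lk}_\Delta(f)=\{g\in\Delta:g\cap f=\emptyset,\ g\cup f\in\Delta\}$. A $(d-1)$-dimensional homology sphere over $\mathbb{K}$ is a pure $(d-1)$-dimensional complex such that for every face $f$ (including $\emptyset$), $\tilde H_i(\mathrm{lk}_\Delta(f);\mathbb{K})$ is $0$ for $i<d-1-|f|$ and $\mathbb{K}$ for $i=d-1-|f|$. Flag: every minimal non-face has two elements. With $f_i$ the number of faces of cardinality $i$ ($f_0=1$) and $h(z)=\sum_{i=0}^d f_i(z-1)^{d-i}$, write uniquely $h(z)=\sum_{i=0}^{\lfloor d/2\rfloor}\gamma_iz^i(1+z)^{d-2i}$ (so $\gamma_1=f_1-2d$), and $\gamma_j:=0$ for $j>\lfloor d/2\rfloor$. Join: $\Delta_1*\Delta_2=\{f_1\sqcup f_2:f_i\in\Delta_i\}$ (disjoint vertex sets); $*^{j}X$ is the $j$-fold join of copies of $X$, with $*^0X=\{\emptyset\}$. Suspension $\Sigma\Delta=S^0*\Delta$ ($S^0$ two isolated vertices), $\Sigma^m$ its $m$-fold iterate.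 $C_5$ is the $5$-cycle graph as a $1$-dimensional complex. *)

theory Defs
  imports Complex_Main "HOL-Computational_Algebra.Polynomial"
begin

section \<open>Simplicial complexes\<close>

text \<open>A complex is identified with its set of faces. Every vertex is a face, so the vertex set is
  the union of the faces.\<close>

definition simplicial_complex :: "'a set set \<Rightarrow> bool" where
  "simplicial_complex \<Delta> \<longleftrightarrow>
     finite \<Delta> \<and> (\<forall>\<sigma>\<in>\<Delta>. finite \<sigma>) \<and> {} \<in> \<Delta> \<and> (\<forall>\<sigma>\<in>\<Delta>. \<forall>\<tau>. \<tau> \<subseteq> \<sigma> \<longrightarrow> \<tau> \<in> \<Delta>)"

definition vertices :: "'a set set \<Rightarrow> 'a set" where
  "vertices \<Delta> = \<Union>\<Delta>"

definition facets :: "'a set set \<Rightarrow> 'a set set" where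
  "facets \<Delta> = {\<sigma> \<in> \<Delta>. \<forall>\<tau>\<in>\<Delta>. \<sigma> \<subseteq> \<tau> \<longrightarrow> \<tau> = \<sigma>}"

text \<open>\<open>pure_complex d \<Delta>\<close>: pure of dimension \<open>d - 1\<close>.\<close>

definition pure_complex :: "nat \<Rightarrow> 'a set set \<Rightarrow> bool" where
  "pure_complex d \<Delta> \<longleftrightarrow> (\<forall>\<sigma>\<in>facets \<Delta>. card \<sigma> = d)"

definition link :: "'a set set \<Rightarrow> 'a set \<Rightarrow> 'a set set" where
  "link \<Delta> f = {g \<in> \<Delta>. g \<inter> f = {} \<and> g \<union> f \<in> \<Delta>}"

definition minimal_nonface :: "'a set set \<Rightarrow> 'a set \<Rightarrow> bool" where
  "minimal_nonface \<Delta> \<sigma> \<longleftrightarrow> \<sigma> \<subseteq> vertices \<Delta> \<and> \<sigma> \<notin> \<Delta> \<and> (\<forall>\<tau>. \<tau> \<subset> \<sigma> \<longrightarrow> \<tau> \<in> \<Delta>)"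

definition flag_complex :: "'a set set \<Rightarrow> bool" where
  "flag_complex \<Delta> \<longleftrightarrow> (\<forall>\<sigma>. minimal_nonface \<Delta> \<sigma> \<longrightarrow> card \<sigma> = 2)"

definition relabel :: "('a \<Rightarrow> 'b) \<Rightarrow> 'a set set \<Rightarrow> 'b set set" where
  "relabel \<phi> \<Delta> = (\<lambda>\<sigma>. \<phi> ` \<sigma>) ` \<Delta>"

definition complex_iso :: "'a set set \<Rightarrow> 'b set set \<Rightarrow> bool" where
  "complex_iso \<Delta> \<Gamma> \<longleftrightarrow>
     (\<exists>\<phi>. bij_betw \<phi> (vertices \<Delta>) (vertices \<Gamma>) \<and> \<Gamma> = relabel \<phi> \<Delta>)"

section \<open>Reduced simplicial homology with coefficients in a field\<close>

text \<open>Faces are oriented by one linear order, chosen once and for all on the whole vertex type.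
  The homology does not depend on this choice up to isomorphism.\<close>

definition vertex_order :: "'a rel" where
  "vertex_order = (SOME r. linear_order r)"

lemma linear_order_vertex_order: "linear_order vertex_order"
proof -
  obtain r :: "'a rel" where "well_order r"
    using well_order_on[of UNIV] by (rule exE)
  then have "linear_order r"
    by (simp add: well_order_on_def)
  then show ?thesis
    unfolding vertex_order_def by (rule someI)
qed

definition vertex_position :: "'a set \<Rightarrow> 'a \<Rightarrow> nat" where
  "vertex_position \<sigma> v = card {w \<in> \<sigma>. w \<noteq> v \<and> (w, v) \<in> vertex_order}"

text \<open>A chain is its coefficient function on faces. Degrees are integers: degree \<open>-1\<close> is spanned
  by the empty face (augmentation), and there are no nonzero chains below that.\<close>

definition chains :: "int \<Rightarrow> 'a set set \<Rightarrow> ('a set \<Rightarrow> 'k::field) set" where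
  "chains i \<Delta> = {c. \<forall>\<sigma>. c \<sigma> \<noteq> 0 \<longrightarrow> \<sigma> \<in> \<Delta> \<and> int (card \<sigma>) = i + 1}"

text \<open>The linear extension of
  \<open>[v\<^sub>0, \<dots>, v\<^sub>i] \<mapsto> \<Sum>j. (-1)^j [v\<^sub>0, \<dots>, v\<^sub>j omitted, \<dots>, v\<^sub>i]\<close>.\<close>

definition boundary :: "'a set set \<Rightarrow> ('a set \<Rightarrow> 'k::field) \<Rightarrow> 'a set \<Rightarrow> 'k" where
  "boundary \<Delta> c = (\<lambda>\<tau>. \<Sum>\<sigma>\<in>\<Delta>. \<Sum>v\<in>\<sigma>.
     if \<sigma> - {v} = \<tau> then (- 1) ^ vertex_position \<sigma> v * c \<sigma> else 0)"

definition cycles :: "int \<Rightarrow> 'a set set \<Rightarrow> ('a set \<Rightarrow> 'k::field) set" where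
  "cycles i \<Delta> = {c \<in> chains i \<Delta>. boundary \<Delta> c = (\<lambda>_. 0)}"

definition boundaries :: "int \<Rightarrow> 'a set set \<Rightarrow> ('a set \<Rightarrow> 'k::field) set" where
  "boundaries i \<Delta> = boundary \<Delta> ` chains (i + 1) \<Delta>"

definition homologous :: "int \<Rightarrow> 'a set set \<Rightarrow> ('a set \<Rightarrow> 'k::field) rel" where
  "homologous i \<Delta> = {(x, y). x \<in> cycles i \<Delta> \<and> y \<in> cycles i \<Delta> \<and> (\<lambda>\<sigma>. x \<sigma> - y \<sigma>) \<in> boundaries i \<Delta>}"

definition reduced_homology :: "int \<Rightarrow> 'a set set \<Rightarrow> ('a set \<Rightarrow> 'k::field) set set" where
  "reduced_homology i \<Delta> = cycles i \<Delta> // homologous i \<Delta>"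

abbreviation homology_class ::
    "int \<Rightarrow> 'a set set \<Rightarrow> ('a set \<Rightarrow> 'k::field) \<Rightarrow> ('a set \<Rightarrow> 'k) set" where
  "homology_class i \<Delta> x \<equiv> homologous i \<Delta> `` {x}"

definition homology_vanishes :: "'k::field itself \<Rightarrow> int \<Rightarrow> 'a set set \<Rightarrow> bool" where
  "homology_vanishes K i \<Delta> \<longleftrightarrow>
     is_singleton (reduced_homology i \<Delta> :: ('a set \<Rightarrow> 'k) set set)"

text \<open>Existence of a \<open>K\<close>-linear isomorphism from the \<open>i\<close>-th reduced homology onto \<open>K\<close>; the vector
  space operations on classes are those induced from cycles.\<close>

definition homology_iso_field :: "'k::field itself \<Rightarrow> int \<Rightarrow> 'a set set \<Rightarrow> bool" where
  "homology_iso_field K i \<Delta> \<longleftrightarrow>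
     (\<exists>\<phi> :: ('a set \<Rightarrow> 'k) set \<Rightarrow> 'k.
        bij_betw \<phi> (reduced_homology i \<Delta>) UNIV \<and>
        (\<forall>x\<in>cycles i \<Delta>. \<forall>y\<in>cycles i \<Delta>.
           \<phi> (homology_class i \<Delta> (\<lambda>\<sigma>. x \<sigma> + y \<sigma>)) =
           \<phi> (homology_class i \<Delta> x) + \<phi> (homology_class i \<Delta> y)) \<and>
        (\<forall>a. \<forall>x\<in>cycles i \<Delta>.
           \<phi> (homology_class i \<Delta> (\<lambda>\<sigma>. a * x \<sigma>)) = a * \<phi> (homology_class i \<Delta> x)))"

text \<open>\<open>homology_sphere TYPE('k) d \<Delta>\<close>: \<open>\<Delta>\<close> is a \<open>(d - 1)\<close>-dimensional homology sphere over \<open>'k\<close>.\<close>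

definition homology_sphere :: "'k::field itself \<Rightarrow> nat \<Rightarrow> 'a set set \<Rightarrow> bool" where
  "homology_sphere K d \<Delta> \<longleftrightarrow>
     simplicial_complex \<Delta> \<and> pure_complex d \<Delta> \<and>
     (\<forall>f\<in>\<Delta>.
        (\<forall>i. i < int d - 1 - int (card f) \<longrightarrow> homology_vanishes K i (link \<Delta> f)) \<and>
        homology_iso_field K (int d - 1 - int (card f)) (link \<Delta> f))"

section \<open>The gamma-vector\<close>

text \<open>Here \<open>f_number \<Delta> i\<close> counts faces of cardinality \<open>i\<close>, not of dimension \<open>i\<close>.\<close>

definition f_number :: "'a set set \<Rightarrow> nat \<Rightarrow> nat" where
  "f_number \<Delta> i = card {\<sigma> \<in> \<Delta>. card \<sigma> = i}"

definition h_poly :: "nat \<Rightarrow> 'a set set \<Rightarrow> int poly" where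
  "h_poly d \<Delta> = (\<Sum>i=0..d. of_nat (f_number \<Delta> i) * [:-1, 1:] ^ (d - i))"

text \<open>The expansion exists (with integer coefficients) exactly when the h-polynomial is palindromic
  of degree at most \<open>d\<close>, as it is for homology spheres; otherwise the value is unspecified.\<close>

definition gamma_vector :: "nat \<Rightarrow> 'a set set \<Rightarrow> nat \<Rightarrow> int" where
  "gamma_vector d \<Delta> = (THE \<gamma>.
     h_poly d \<Delta> = (\<Sum>i=0..d div 2. [:\<gamma> i:] * [:0, 1:] ^ i * [:1, 1:] ^ (d - 2 * i)) \<and>
     (\<forall>j > d div 2. \<gamma> j = 0))"

section \<open>Joins, suspensions and the 5-cycle\<close>

text \<open>To be applied to complexes on disjoint vertex sets; below, disjoint copies are produced by
  tagging vertices.\<close>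

definition join :: "'a set set \<Rightarrow> 'a set set \<Rightarrow> 'a set set" where
  "join \<Delta>\<^sub>1 \<Delta>\<^sub>2 = {f\<^sub>1 \<union> f\<^sub>2 | f\<^sub>1 f\<^sub>2. f\<^sub>1 \<in> \<Delta>\<^sub>1 \<and> f\<^sub>2 \<in> \<Delta>\<^sub>2}"

primrec iterated_join :: "nat \<Rightarrow> 'a set set \<Rightarrow> (nat \<times> 'a) set set" where
  "iterated_join 0 X = {{}}"
| "iterated_join (Suc j) X = join (iterated_join j X) (relabel (Pair j) X)"

definition sphere0 :: "bool set set" where
  "sphere0 = {{}, {False}, {True}}"

text \<open>The two suspension vertices added in step \<open>k\<close> are \<open>Inr (k, False)\<close> and \<open>Inr (k, True)\<close>.\<close>

primrec iterated_suspension :: "nat \<Rightarrow> 'a set set \<Rightarrow> ('a + nat \<times> bool) set set" where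
  "iterated_suspension 0 \<Delta> = relabel Inl \<Delta>"
| "iterated_suspension (Suc k) \<Delta> =
     join (relabel (\<lambda>b. Inr (k, b)) sphere0) (iterated_suspension k \<Delta>)"

definition cycle5 :: "nat set set" where
  "cycle5 = {{}} \<union> {{i} | i. i < 5} \<union> {{i, (i + 1) mod 5} | i. i < 5}"

end

theory Submission
  imports Defs "HOL-Library.Function_Algebras"
begin

text \<open>Let \<open>n\<close> be the number of vertices and \<open>N\<close> the number of non-adjacent pairs. Counting edges by
  the \<open>\<gamma>\<close>-vector, \<open>\<gamma>\<^sub>2 \<le> (l choose 2)\<close> becomes \<open>N \<ge> 3 n - 5 d\<close>. This holds for every flag complex that is
  pure with each ridge in exactly two facets, by induction on \<open>d\<close>: for a vertex \<open>v\<close> with link on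
  \<open>L\<close> and set of non-neighbours \<open>U\<close>, each facet of the link of \<open>v\<close> extends by exactly one vertex of
  \<open>U\<close>. So if some \<open>u \<in> U\<close> is adjacent to all of \<open>L\<close>, the other members of \<open>U\<close> have at least two
  non-neighbours in \<open>L\<close>. Otherwise at most two members of \<open>U\<close> have just one: if \<open>u\<close>, \<open>u'\<close> have \<open>w\<close>, \<open>w'\<close>
  as their only ones, every facet of the link meets \<open>{w, w'}\<close>, which forces the link to be the
  suspension of a complex by \<open>w\<close>, \<open>w'\<close>. Either way at least \<open>2 |U| - 2\<close>
  non-adjacent pairs run between \<open>U\<close> and \<open>L\<close>. In the case of equality the graph of non-adjacency has a component that is
  either a single edge (a suspension) or, with \<open>v, u, u', w, w'\<close> as above, a 5-cycle.

  Homology enters only through the Euler characteristics of links, which give the two facets at a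
  ridge and the Dehn--Sommerville equations, hence the existence of the \<open>\<gamma>\<close>-vector.\<close>

section \<open>Non-adjacency in flag pseudomanifolds\<close>

lemma lessThan_5: "{..<5::nat} = {0, 1, 2, 3, 4}"
  by auto

text \<open>Each vertex of a pentagon has exactly two vertices opposite to it; this yields the count
  of 10 ordered pairs in \<open>decomposes_counts\<close>.\<close>

lemma pentagon_opposite:
  assumes "i < 5"
  shows "{j \<in> {..<5}. j = (i + 2) mod 5 \<or> i = (j + 2) mod 5} = {(i + 2) mod 5, (i + 3) mod (5::nat)}"
proof (rule set_eqI)
  fix j :: nat
  show "j \<in> {j \<in> {..<5}. j = (i + 2) mod 5 \<or> i = (j + 2) mod 5} \<longleftrightarrow> j \<in> {(i + 2) mod 5, (i + 3) mod 5}"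
  proof (cases "j < 5")
    case True
    then have "j = 0 \<or> j = 1 \<or> j = 2 \<or> j = 3 \<or> j = 4" by auto
    moreover have "i = 0 \<or> i = 1 \<or> i = 2 \<or> i = 3 \<or> i = 4" using assms by auto
    ultimately show ?thesis by (elim disjE) simp_all
  next
    case False
    have "(i + 2) mod 5 < 5" "(i + 3) mod 5 < 5" by simp_all
    with False show ?thesis by force
  qed
qed

text \<open>A flag complex is determined by its graph. With \<open>R\<close> as non-adjacency these
  are its faces, so that complexes and their links can be handled through vertex sets alone.\<close>

definition independent_sets :: "('a \<Rightarrow> 'a \<Rightarrow> bool) \<Rightarrow> 'a set \<Rightarrow> 'a set set" where
  "independent_sets R V = {\<sigma>. \<sigma> \<subseteq> V \<and> (\<forall>x\<in>\<sigma>. \<forall>y\<in>\<sigma>. \<not> R x y)}"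

locale incompatibility =
  fixes R :: "'a \<Rightarrow> 'a \<Rightarrow> bool"
  assumes R_sym: "R x y \<Longrightarrow> R y x" and R_irrefl: "\<not> R x x"
begin

abbreviation indep :: "'a set \<Rightarrow> 'a set set" where
  "indep \<equiv> independent_sets R"

text \<open>Purity is split into extendability to a face of size \<open>d\<close> and the bound
  \<open>d\<close>, which avoids speaking of maximal faces. The last clause puts each ridge in
  exactly two facets.\<close>

definition pseudomanifold :: "nat \<Rightarrow> 'a set \<Rightarrow> bool" where
  "pseudomanifold d V \<longleftrightarrow> finite V \<and>
     (\<forall>\<sigma>\<in>indep V. \<exists>\<tau>\<in>indep V. \<sigma> \<subseteq> \<tau> \<and> card \<tau> = d) \<and>
     (\<forall>\<sigma>\<in>indep V. card \<sigma> \<le> d) \<and>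
     (\<forall>\<sigma>\<in>indep V. card \<sigma> + 1 = d \<longrightarrow> card {x \<in> V - \<sigma>. insert x \<sigma> \<in> indep V} = 2)"

text \<open>This is the vertex set of the link of \<open>v\<close>; by \<open>indep_nbh\<close> the
  link itself is \<open>indep (nbh V v)\<close>.\<close>

definition nbh :: "'a set \<Rightarrow> 'a \<Rightarrow> 'a set" where
  "nbh V v = {w \<in> V. w \<noteq> v \<and> \<not> R v w}"

definition opp :: "'a set \<Rightarrow> 'a \<Rightarrow> 'a set" where
  "opp V v = {w \<in> V. R v w}"

text \<open>Ordered pairs are counted, so this is twice the number of non-edges; hence the doubled
  constants 6 and 10 below.\<close>

definition npairs :: "'a set \<Rightarrow> nat" where
  "npairs V = (\<Sum>x\<in>V. card (opp V x))"

lemma indep_subset: "\<sigma> \<in> indep V \<Longrightarrow> \<tau> \<subseteq> \<sigma> \<Longrightarrow> \<tau> \<in> indep V"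
  by (auto simp: independent_sets_def)

lemma indep_insert:
  "insert x \<sigma> \<in> indep V \<longleftrightarrow> x \<in> V \<and> \<sigma> \<in> indep V \<and> (\<forall>y\<in>\<sigma>. \<not> R x y)"
  using R_sym R_irrefl by (auto simp: independent_sets_def)

lemma indep_nbh:
  assumes "v \<in> V"
  shows "\<sigma> \<in> indep (nbh V v) \<longleftrightarrow> v \<notin> \<sigma> \<and> insert v \<sigma> \<in> indep V"
  using assms by (auto simp: indep_insert) (auto simp: independent_sets_def nbh_def)

lemma indep_finite: "finite V \<Longrightarrow> \<sigma> \<in> indep V \<Longrightarrow> finite \<sigma>"
  by (auto simp: independent_sets_def intro: finite_subset)

lemma pseudomanifoldD:
  assumes "pseudomanifold d V"
  shows "finite V" "\<sigma> \<in> indep V \<Longrightarrow> \<exists>\<tau>\<in>indep V. \<sigma> \<subseteq> \<tau> \<and> card \<tau> = d"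
    "\<sigma> \<in> indep V \<Longrightarrow> card \<sigma> \<le> d"
    "\<sigma> \<in> indep V \<Longrightarrow> card \<sigma> + 1 = d \<Longrightarrow> card {x \<in> V - \<sigma>. insert x \<sigma> \<in> indep V} = 2"
  using assms by (auto simp: pseudomanifold_def)

text \<open>Faces of the link are the faces through \<open>v\<close> with \<open>v\<close> removed,
  so purity and the ridge condition carry over with sizes lowered by one. This drives every
  induction on \<open>d\<close>.\<close>

lemma pseudomanifold_nbh:
  assumes pm: "pseudomanifold d V" and v: "v \<in> V"
  obtains e where "d = Suc e" "pseudomanifold e (nbh V v)"
proof -
  have fin: "finite V" using pm by (rule pseudomanifoldD)
  have "{v} \<in> indep V" using v R_irrefl by (auto simp: independent_sets_def)
  then have "1 \<le> d" using pseudomanifoldD(3)[OF pm, of "{v}"] by simp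
  then obtain e where d: "d = Suc e" by (cases d) auto
  have "pseudomanifold e (nbh V v)"
    unfolding pseudomanifold_def
  proof (intro conjI ballI impI)
    show "finite (nbh V v)" using fin by (simp add: nbh_def)
  next
    fix \<sigma> assume s: "\<sigma> \<in> indep (nbh V v)"
    then have vs: "v \<notin> \<sigma>" and iv: "insert v \<sigma> \<in> indep V" using indep_nbh[OF v] by auto
    have fs: "finite \<sigma>" using indep_finite[OF fin iv] by simp
    obtain \<tau> where t: "\<tau> \<in> indep V" "insert v \<sigma> \<subseteq> \<tau>" "card \<tau> = d"
      using pseudomanifoldD(2)[OF pm iv] by auto
    have "\<tau> - {v} \<in> indep (nbh V v)" using t indep_nbh[OF v] by (simp add: insert_absorb)
    moreover have "\<sigma> \<subseteq> \<tau> - {v}" using t vs by auto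
    moreover have "card (\<tau> - {v}) = e" using t d by simp
    ultimately show "\<exists>\<tau>\<in>indep (nbh V v). \<sigma> \<subseteq> \<tau> \<and> card \<tau> = e" by blast
    show "card \<sigma> \<le> e" using pseudomanifoldD(3)[OF pm iv] vs fs d by simp
    assume "card \<sigma> + 1 = e"
    then have "card (insert v \<sigma>) + 1 = d" using vs fs d by simp
    then have "card {x \<in> V - insert v \<sigma>. insert x (insert v \<sigma>) \<in> indep V} = 2"
      using pseudomanifoldD(4)[OF pm iv] by simp
    moreover have "{x \<in> V - insert v \<sigma>. insert x (insert v \<sigma>) \<in> indep V}
      = {x \<in> nbh V v - \<sigma>. insert x \<sigma> \<in> indep (nbh V v)}"
      using indep_nbh[OF v] vs v by (auto simp: insert_commute indep_insert nbh_def dest: R_sym)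
    ultimately show "card {x \<in> nbh V v - \<sigma>. insert x \<sigma> \<in> indep (nbh V v)} = 2" by simp
  qed
  with d that show ?thesis by blast
qed

section \<open>Exchanging vertices of facets across ridges\<close>

lemma facet_exists:
  assumes "pseudomanifold d V" "v \<in> V"
  obtains F where "F \<in> indep V" "v \<in> F" "card F = d"
proof -
  have "{v} \<in> indep V" using assms R_irrefl by (auto simp: independent_sets_def)
  from pseudomanifoldD(2)[OF assms(1) this] that show thesis by auto
qed

text \<open>The ridge \<open>F - {w}\<close> lies in exactly two facets, and \<open>F\<close> is one
  of them; the other one supplies \<open>x\<close>.\<close>

lemma ridge_swap:
  assumes pm: "pseudomanifold d V" and F: "F \<in> indep V" "card F = d" and w: "w \<in> F"
  obtains x where "x \<in> V" "x \<notin> F" "insert x (F - {w}) \<in> indep V" "card (insert x (F - {w})) = d"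
proof -
  have fF: "finite F" using indep_finite pseudomanifoldD(1)[OF pm] F by blast
  have F': "F - {w} \<in> indep V" using F indep_subset by blast
  have "d > 0" using F w fF by (metis card_gt_0_iff empty_iff)
  then have "card (F - {w}) + 1 = d" using F w fF by simp
  then have "card {x \<in> V - (F - {w}). insert x (F - {w}) \<in> indep V} = 2"
    using pseudomanifoldD(4)[OF pm F'] by simp
  then obtain x where x: "x \<in> {x \<in> V - (F - {w}). insert x (F - {w}) \<in> indep V}" "x \<noteq> w"
    unfolding card_2_iff by (metis insertCI)
  then have "x \<notin> F" by auto
  moreover from this have "card (insert x (F - {w})) = d"
    using \<open>card (F - {w}) + 1 = d\<close> fF by simp
  ultimately show thesis using that x by auto
qed

lemma facet_avoiding:
  assumes "pseudomanifold d V" "w \<in> V"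
  obtains F where "F \<in> indep V" "w \<notin> F" "card F = d"
proof -
  obtain F where F: "F \<in> indep V" "w \<in> F" "card F = d" using facet_exists[OF assms] .
  obtain x where "x \<notin> F" "insert x (F - {w}) \<in> indep V" "card (insert x (F - {w})) = d"
    using ridge_swap[OF assms(1) F(1,3,2)] by blast
  with that[of "insert x (F - {w})"] F(2) show thesis by blast
qed

text \<open>A facet \<open>F\<close> of the link of \<open>v\<close> is a ridge of the whole
  complex. One of its two facets is \<open>insert v F\<close>; the vertex completing the other is
  the required \<open>u\<close>.\<close>

lemma facet_unique_opp:
  assumes pm: "pseudomanifold (Suc e) V" and v: "v \<in> V"
    and F: "F \<in> indep (nbh V v)" "card F = e"
  shows "\<exists>!u. u \<in> opp V v \<and> (\<forall>x\<in>F. \<not> R u x)"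
proof -
  have fin: "finite V" using pm by (rule pseudomanifoldD)
  have vF: "v \<notin> F" and vF': "insert v F \<in> indep V" using F indep_nbh[OF v] by auto
  then have FV: "F \<in> indep V" by (simp add: indep_insert)
  have fF: "finite F" using indep_finite[OF fin FV] .
  let ?X = "{x \<in> V - F. insert x F \<in> indep V}"
  have "card ?X = 2" using pseudomanifoldD(4)[OF pm FV] F by simp
  moreover have "v \<in> ?X" using v vF vF' by simp
  ultimately have c: "card (?X - {v}) = 1" by simp
  have "?X - {v} = {u. u \<in> opp V v \<and> (\<forall>x\<in>F. \<not> R u x)}"
  proof (intro equalityI subsetI)
    fix u assume u: "u \<in> ?X - {v}"
    have "R v u"
    proof (rule ccontr)
      \<comment> \<open>Otherwise \<open>u\<close>, \<open>v\<close> and \<open>F\<close> together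
        form a face with \<open>e + 2\<close> vertices.\<close>
      assume "\<not> R v u"
      then have "insert u (insert v F) \<in> indep V"
        using u vF' R_sym by (auto simp: indep_insert)
      then have "card (insert u (insert v F)) \<le> Suc e" by (rule pseudomanifoldD(3)[OF pm])
      then show False using u vF fF F by simp
    qed
    then show "u \<in> {u. u \<in> opp V v \<and> (\<forall>x\<in>F. \<not> R u x)}"
      using u by (auto simp: opp_def indep_insert)
  next
    fix u assume u: "u \<in> {u. u \<in> opp V v \<and> (\<forall>x\<in>F. \<not> R u x)}"
    then have "u \<noteq> v" "u \<notin> F" using F R_irrefl
      by (auto simp: opp_def nbh_def independent_sets_def)
    then show "u \<in> ?X - {v}" using u FV by (auto simp: opp_def indep_insert)
  qed
  with c obtain u where "{u. u \<in> opp V v \<and> (\<forall>x\<in>F. \<not> R u x)} = {u}"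
    by (auto simp: card_1_singleton_iff)
  then show ?thesis by (intro ex1I[of _ u]) blast+
qed

text \<open>If \<open>w\<close> and \<open>w'\<close> were compatible, replacing first \<open>w\<close> and then \<open>w'\<close> in a common facet would
  bring back \<open>w\<close> and exhibit a triangle as the link of a codimension two face.\<close>

lemma hitting_pair_incompatible:
  assumes pm: "pseudomanifold d V" and w: "w \<in> V" "w' \<in> V" "w \<noteq> w'"
    and hit: "\<And>F. F \<in> indep V \<Longrightarrow> card F = d \<Longrightarrow> w \<in> F \<or> w' \<in> F"
  shows "R w w'"
proof (rule ccontr)
  assume nR: "\<not> R w w'"
  then have "{w, w'} \<in> indep V" using w R_irrefl R_sym by (auto simp: independent_sets_def)
  then obtain F where F: "F \<in> indep V" "w \<in> F" "w' \<in> F" "card F = d"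
    using pseudomanifoldD(2)[OF pm] by (metis insert_subset)
  obtain x where x: "x \<notin> F" "insert x (F - {w}) \<in> indep V" "card (insert x (F - {w})) = d"
    using ridge_swap[OF pm F(1,4,2)] by metis
  have "w' \<in> insert x (F - {w})" using F w by auto
  then obtain y where y: "y \<notin> insert x (F - {w})"
      "insert y (insert x (F - {w}) - {w'}) \<in> indep V"
      "card (insert y (insert x (F - {w}) - {w'})) = d"
    using ridge_swap[OF pm x(2,3)] by metis
  have "y = w" using hit[OF y(2,3)] x(1) y(1) F w by auto
  moreover have "x \<noteq> w'" using x F by auto
  ultimately have "\<not> R w x" using y(2) by (auto simp: indep_insert)
  then have "insert x F \<in> indep V"
    using x(2) F R_sym by (auto simp: indep_insert)
  from pseudomanifoldD(3)[OF pm this] show False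
    using x(1) F indep_finite[OF pseudomanifoldD(1)[OF pm] F(1)] by simp
qed

text \<open>If a facet through \<open>x\<close> misses \<open>w\<close>, it contains
  \<open>w'\<close>. Swapping \<open>w'\<close> out must bring in \<open>w\<close>, since the new
  facet meets the pair as well; so \<open>w\<close> and \<open>x\<close> lie in a common
  face.\<close>

lemma hitting_pair_compatible_rest:
  assumes pm: "pseudomanifold d V" and w: "w \<in> V" "w' \<in> V" "w \<noteq> w'"
    and hit: "\<And>F. F \<in> indep V \<Longrightarrow> card F = d \<Longrightarrow> w \<in> F \<or> w' \<in> F"
    and x: "x \<in> V" "x \<noteq> w'"
  shows "\<not> R w x"
proof (cases "x = w")
  case True then show ?thesis using R_irrefl by simp
next
  case False
  obtain F where F: "F \<in> indep V" "x \<in> F" "card F = d" using facet_exists[OF pm x(1)] .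
  show ?thesis
  proof (cases "w \<in> F")
    case True then show ?thesis using F by (auto simp: independent_sets_def)
  next
    case False
    then have w'F: "w' \<in> F" using hit F by auto
    obtain y where y: "y \<notin> F" "insert y (F - {w'}) \<in> indep V" "card (insert y (F - {w'})) = d"
      using ridge_swap[OF pm F(1,3) w'F] by metis
    then have "y = w" using hit[OF y(2,3)] False w'F by auto
    then show ?thesis using y(2) F(2) x(2) by (auto simp: indep_insert)
  qed
qed

section \<open>Counting non-adjacent pairs around a vertex\<close>

lemma sum_card_opp_swap:
  assumes "finite A" "finite B"
  shows "(\<Sum>a\<in>A. card (opp B a)) = (\<Sum>b\<in>B. card (opp A b))"
proof -
  have c: "card (opp D a) = (\<Sum>b\<in>D. if R a b then 1 else 0)" if "finite D" for D a
    using that by (simp add: opp_def sum.If_cases Int_def)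
  have "(\<Sum>a\<in>A. card (opp B a)) = (\<Sum>a\<in>A. \<Sum>b\<in>B. if R a b then 1 else 0)"
    using assms c by simp
  also have "\<dots> = (\<Sum>b\<in>B. \<Sum>a\<in>A. if R a b then 1 else 0)" by (rule sum.swap)
  also have "\<dots> = (\<Sum>b\<in>B. \<Sum>a\<in>A. if R b a then 1 else 0)"
    using R_sym by (intro sum.cong refl) meson
  finally show ?thesis using assms c by simp
qed

lemma npairs_Un:
  assumes "finite A" "finite B" "A \<inter> B = {}"
  shows "npairs (A \<union> B) = npairs A + npairs B + 2 * (\<Sum>a\<in>A. card (opp B a))"
proof -
  have "card (opp (A \<union> B) x) = card (opp A x) + card (opp B x)" for x
  proof -
    have "opp (A \<union> B) x = opp A x \<union> opp B x" "opp A x \<inter> opp B x = {}"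
      using assms by (auto simp: opp_def)
    then show ?thesis using assms by (simp add: card_Un_disjoint opp_def)
  qed
  then show ?thesis
    using assms sum_card_opp_swap[OF assms(1,2)]
    by (simp add: npairs_def sum.union_disjoint sum.distrib)
qed

lemma vertex_decomposition:
  assumes "v \<in> V"
  shows "V = insert v (opp V v \<union> nbh V v)" "v \<notin> opp V v \<union> nbh V v" "opp V v \<inter> nbh V v = {}"
  using assms R_irrefl by (auto simp: opp_def nbh_def)

lemma card_decomposition:
  assumes "finite V" "v \<in> V"
  shows "card V = 1 + card (opp V v) + card (nbh V v)"
proof -
  note d = vertex_decomposition[OF assms(2)]
  have f: "finite (opp V v)" "finite (nbh V v)" using assms by (auto simp: opp_def nbh_def)
  have "card V = card (insert v (opp V v \<union> nbh V v))" using d(1) by simp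
  also have "\<dots> = 1 + card (opp V v) + card (nbh V v)"
    using d(2,3) f by (simp add: card_Un_disjoint)
  finally show ?thesis .
qed

lemma npairs_decomposition:
  assumes "finite V" "v \<in> V"
  shows "npairs V = npairs (nbh V v) + npairs (opp V v) + 2 * card (opp V v)
    + 2 * (\<Sum>u\<in>opp V v. card (opp (nbh V v) u))"
proof -
  note d = vertex_decomposition[OF assms(2)]
  have f: "finite (opp V v)" "finite (nbh V v)" using assms by (auto simp: opp_def nbh_def)
  let ?W = "opp V v \<union> nbh V v"
  have "opp ?W v = opp V v" using assms by (auto simp: opp_def nbh_def)
  moreover have "npairs {v} = 0" using R_irrefl by (simp add: npairs_def opp_def)
  moreover have "npairs ({v} \<union> ?W) = npairs {v} + npairs ?W + 2 * (\<Sum>a\<in>{v}. card (opp ?W a))"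
    by (rule npairs_Un) (use f d in auto)
  moreover have "{v} \<union> ?W = V" using d by simp
  ultimately show ?thesis using npairs_Un[OF f d(3)] by simp
qed

text \<open>A facet of the link missing both vertices would extend by \<open>u\<close> as well as by
  \<open>u'\<close>, against uniqueness. Inclusions instead of equalities also admit a
  \<open>u\<close> with no non-neighbour in the link.\<close>

lemma opp_card_1_hits:
  assumes pm: "pseudomanifold (Suc e) V" and v: "v \<in> V"
    and u: "u \<in> opp V v" "u' \<in> opp V v" "u \<noteq> u'"
    and w: "opp (nbh V v) u \<subseteq> {w}" and w': "opp (nbh V v) u' \<subseteq> {w'}"
    and F: "F \<in> indep (nbh V v)" "card F = e"
  shows "w \<in> F \<or> w' \<in> F"
proof (rule ccontr)
  assume "\<not> ?thesis"
  moreover have "F \<subseteq> nbh V v" using F by (simp add: independent_sets_def)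
  ultimately have "\<forall>x\<in>F. \<not> R u x" "\<forall>x\<in>F. \<not> R u' x" using w w' by (auto simp: opp_def)
  with facet_unique_opp[OF pm v F] u show False by blast
qed

text \<open>Such a \<open>u\<close> extends every facet of the link, so \<open>u'\<close> may extend
  none. With at most one non-neighbour \<open>w\<close> in the link, \<open>u'\<close> would extend
  a facet avoiding \<open>w\<close>.\<close>

lemma opp_empty_unique:
  assumes pm: "pseudomanifold (Suc e) V" and v: "v \<in> V" and pmL: "pseudomanifold e (nbh V v)"
    and u: "u \<in> opp V v" "u' \<in> opp V v" "u \<noteq> u'" and 0: "opp (nbh V v) u = {}"
  shows "2 \<le> card (opp (nbh V v) u')"
proof (rule ccontr)
  let ?L = "nbh V v"
  assume "\<not> ?thesis"
  moreover have fin: "finite (opp ?L u')" using pseudomanifoldD(1)[OF pmL] by (simp add: opp_def)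
  ultimately consider "opp ?L u' = {}" | w where "opp ?L u' = {w}"
    by (auto simp: not_le less_2_cases_iff card_1_singleton_iff)
  then show False
  proof cases
    case 1
    have "{} \<in> indep ?L" by (simp add: independent_sets_def)
    then obtain F where "F \<in> indep ?L" "card F = e" using pseudomanifoldD(2)[OF pmL] by blast
    then obtain F where F: "F \<in> indep ?L" "card F = e" by blast
    have "F \<subseteq> ?L" using F by (simp add: independent_sets_def)
    then have "\<forall>x\<in>F. \<not> R u x" "\<forall>x\<in>F. \<not> R u' x" using 0 1 by (auto simp: opp_def)
    with facet_unique_opp[OF pm v F] u show False by blast
  next
    case (2 w)
    then have wL: "w \<in> ?L" by (auto simp: opp_def)
    obtain F where F: "F \<in> indep ?L" "w \<notin> F" "card F = e" using facet_avoiding[OF pmL wL] .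
    \<comment> \<open>Since \<open>opp ?L u\<close> is empty, the same \<open>w\<close> can serve
      for both \<open>u\<close> and \<open>u'\<close>.\<close>
    have "w \<in> F \<or> w \<in> F"
      by (rule opp_card_1_hits[OF pm v u _ _ F(1,3)]) (use 0 2 in auto)
    with F show False by simp
  qed
qed

text \<open>By \<open>opp_card_1_hits\<close> every facet of the link meets \<open>{w, w'}\<close>,
  so the two lemmas on hitting pairs apply to the link. Used in both orders, this makes
  \<open>w\<close> and \<open>w'\<close> a suspension pair of the link.\<close>

lemma opp_card_1_pair:
  assumes pm: "pseudomanifold (Suc e) V" and v: "v \<in> V" and pmL: "pseudomanifold e (nbh V v)"
    and u: "u \<in> opp V v" "u' \<in> opp V v" "u \<noteq> u'"
    and w: "opp (nbh V v) u = {w}" and w': "opp (nbh V v) u' = {w'}"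
  shows "w \<noteq> w'" "R w w'" "x \<in> nbh V v \<Longrightarrow> x \<noteq> w' \<Longrightarrow> \<not> R w x"
proof -
  let ?L = "nbh V v"
  have L: "w \<in> ?L" "w' \<in> ?L" using w w' by (auto simp: opp_def)
  have hit: "w \<in> F \<or> w' \<in> F" if "F \<in> indep ?L" "card F = e" for F
    by (rule opp_card_1_hits[OF pm v u _ _ that]) (use w w' in auto)
  show ne: "w \<noteq> w'" using hit facet_avoiding[OF pmL L(1)] by metis
  show "R w w'" using hitting_pair_incompatible[OF pmL L ne] hit by blast
  show "\<not> R w x" if "x \<in> ?L" "x \<noteq> w'"
    using hitting_pair_compatible_rest[OF pmL L ne _ that] hit by blast
qed

text \<open>Each member of \<open>opp V v\<close> is expected to contribute 2, and the total
  shortfall is at most 2: either one vertex falls short by 2, or at most two vertices fall short by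
  1.\<close>

lemma sum_opp_nbh_ge:
  assumes pm: "pseudomanifold (Suc e) V" and v: "v \<in> V" and pmL: "pseudomanifold e (nbh V v)"
  shows "2 * card (opp V v) \<le> (\<Sum>u\<in>opp V v. card (opp (nbh V v) u)) + 2"
proof -
  let ?L = "nbh V v" and ?U = "opp V v"
  let ?k = "\<lambda>u. card (opp ?L u)"
  have fin: "finite ?U" using pseudomanifoldD(1)[OF pm] by (simp add: opp_def)
  have finL: "finite ?L" using pseudomanifoldD(1)[OF pmL] .
  show ?thesis
  proof (cases "\<exists>u\<in>?U. ?k u = 0")
    case True
    then obtain u where u: "u \<in> ?U" "opp ?L u = {}" using finL by (auto simp: opp_def)
    have "(\<Sum>u'\<in>?U - {u}. 2) \<le> (\<Sum>u'\<in>?U - {u}. ?k u')"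
      by (rule sum_mono) (use opp_empty_unique[OF pm v pmL u(1) _ _ u(2)] in auto)
    moreover have "sum ?k (?U - {u}) \<le> sum ?k ?U"
      by (rule sum_mono2) (use fin in auto)
    moreover have "card ?U = Suc (card (?U - {u}))" using card_Suc_Diff1[OF fin u(1)] by simp
    ultimately show ?thesis by simp
  next
    case False
    define T where "T = {u \<in> ?U. ?k u = 1}"
    \<comment> \<open>Three vertices in \<open>T\<close> would make \<open>w1\<close> incompatible
      with both \<open>w2\<close> and \<open>w3\<close>, while inside the link its only incompatible
      partner is \<open>w2\<close>.\<close>
    have "card T \<le> 2"
    proof (rule ccontr)
      assume "\<not> card T \<le> 2"
      then have "3 \<le> card T" by simp
      then obtain S where "S \<subseteq> T" "card S = 3" by (rule obtain_subset_with_card_n)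
      then obtain u1 u2 u3 where u: "u1 \<in> T" "u2 \<in> T" "u3 \<in> T" "u1 \<noteq> u2" "u1 \<noteq> u3" "u2 \<noteq> u3"
        unfolding card_3_iff by blast
      then obtain w1 w2 w3 where w: "opp ?L u1 = {w1}" "opp ?L u2 = {w2}" "opp ?L u3 = {w3}"
        unfolding T_def by (auto simp: card_1_singleton_iff)
      have uU: "u1 \<in> ?U" "u2 \<in> ?U" "u3 \<in> ?U" using u by (auto simp: T_def)
      have "R w1 w3" using opp_card_1_pair(2)[OF pm v pmL uU(1,3) u(5) w(1,3)] .
      moreover have "w3 \<noteq> w2" using opp_card_1_pair(1)[OF pm v pmL uU(2,3) u(6) w(2,3)] by simp
      moreover have "w3 \<in> ?L" using w by (auto simp: opp_def)
      ultimately show False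
        using opp_card_1_pair(3)[OF pm v pmL uU(1,2) u(4) w(1,2)] by blast
    qed
    have "2 * card ?U = (\<Sum>u\<in>?U. 2)" by simp
    also have "\<dots> \<le> (\<Sum>u\<in>?U. ?k u + (if u \<in> T then 1 else 0))"
    proof (rule sum_mono)
      fix u assume "u \<in> ?U"
      with False have "?k u \<noteq> 0" by simp
      with \<open>u \<in> ?U\<close> show "2 \<le> ?k u + (if u \<in> T then 1 else 0)" by (auto simp: T_def)
    qed
    also have "\<dots> = sum ?k ?U + card T"
      using fin by (simp add: sum.distrib sum.If_cases T_def Int_def)
    finally show ?thesis using \<open>card T \<le> 2\<close> by simp
  qed
qed

lemma pseudomanifold_0: "pseudomanifold 0 V \<Longrightarrow> V = {}"
  by (rule equals0I) (auto elim: pseudomanifold_nbh)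

lemma pseudomanifold_nonempty: "pseudomanifold (Suc e) V \<Longrightarrow> V \<noteq> {}"
  using pseudomanifoldD(2)[of "Suc e" V "{}"] by (auto simp: independent_sets_def)

text \<open>With \<open>k = card (opp V v)\<close>, the vertex \<open>v\<close> itself accounts for
  \<open>2 * k\<close> ordered pairs and those between \<open>opp V v\<close> and the link for at
  least \<open>4 * k - 4\<close>. Dropping the pairs inside \<open>opp V v\<close> leaves the
  induction hypothesis for the link.\<close>

theorem npairs_ge: "pseudomanifold d V \<Longrightarrow> 6 * card V \<le> npairs V + 10 * d"
proof (induction d arbitrary: V)
  case 0
  then show ?case using pseudomanifold_0 by fastforce
next
  case (Suc e)
  then obtain v where v: "v \<in> V" using pseudomanifold_nonempty[OF Suc.prems] by blast
  have pmL: "pseudomanifold e (nbh V v)" using pseudomanifold_nbh[OF Suc.prems v] by auto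
  have fin: "finite V" using Suc.prems by (rule pseudomanifoldD)
  define S where "S = (\<Sum>u\<in>opp V v. card (opp (nbh V v) u))"
  show ?case
    using Suc.IH[OF pmL] sum_opp_nbh_ge[OF Suc.prems v pmL, folded S_def]
      npairs_decomposition[OF fin v, folded S_def] card_decomposition[OF fin v]
    unfolding mult_Suc_right by linarith
qed

section \<open>The case of equality\<close>

definition extremal :: "nat \<Rightarrow> 'a set \<Rightarrow> bool" where
  "extremal d V \<longleftrightarrow> pseudomanifold d V \<and> npairs V + 10 * d = 6 * card V"

text \<open>The induction step of \<open>npairs_ge\<close> works at any vertex \<open>v\<close>.
  Equality in the conclusion therefore forces equality in each estimate of that step, at every
  \<open>v\<close>.\<close>

lemma extremal_nbh:
  assumes ex: "extremal d V" and v: "v \<in> V"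
  obtains e where "d = Suc e" "extremal e (nbh V v)"
    "(\<Sum>u\<in>opp V v. card (opp (nbh V v) u)) + 2 = 2 * card (opp V v)"
    "npairs (opp V v) = 0"
proof -
  have pm: "pseudomanifold d V" using ex by (simp add: extremal_def)
  obtain e where e: "d = Suc e" "pseudomanifold e (nbh V v)" using pseudomanifold_nbh[OF pm v] .
  have fin: "finite V" using pm by (rule pseudomanifoldD)
  have "npairs V + 10 * d = 6 * card V" using ex by (simp add: extremal_def)
  moreover define S where "S = (\<Sum>u\<in>opp V v. card (opp (nbh V v) u))"
  ultimately have "npairs (nbh V v) + 10 * e = 6 * card (nbh V v) \<and> S + 2 = 2 * card (opp V v) \<and>
    npairs (opp V v) = 0"
    using npairs_ge[OF e(2)] sum_opp_nbh_ge[OF pm[unfolded e(1)] v e(2), folded S_def]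
      npairs_decomposition[OF fin v, folded S_def] card_decomposition[OF fin v] e(1) by linarith
  with that e show thesis by (simp add: extremal_def S_def)
qed

text \<open>\<open>R\<close> being non-adjacency, \<open>p\<close> lists a pentagon in the cyclic order of the complex, not of \<open>R\<close>.\<close>

inductive decomposes :: "nat \<Rightarrow> nat \<Rightarrow> 'a set \<Rightarrow> bool" where
  empty: "decomposes 0 0 {}"
| suspension: "decomposes m l V \<Longrightarrow> a \<noteq> b \<Longrightarrow> a \<notin> V \<Longrightarrow> b \<notin> V \<Longrightarrow> R a b \<Longrightarrow>
    (\<And>x. x \<in> V \<Longrightarrow> \<not> R a x \<and> \<not> R b x) \<Longrightarrow> decomposes (Suc m) l (V \<union> {a, b})"
| pentagon: "decomposes m l V \<Longrightarrow> inj_on p {..<5} \<Longrightarrow> p ` {..<5} \<inter> V = {} \<Longrightarrow>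
    (\<And>i j. i < 5 \<Longrightarrow> j < 5 \<Longrightarrow> R (p i) (p j) \<longleftrightarrow> j = (i + 2) mod 5 \<or> i = (j + 2) mod 5) \<Longrightarrow>
    (\<And>i x. i < 5 \<Longrightarrow> x \<in> V \<Longrightarrow> \<not> R (p i) x) \<Longrightarrow> decomposes m (Suc l) (V \<union> p ` {..<5::nat})"

lemma npairs_0: "finite A \<Longrightarrow> npairs A = 0 \<Longrightarrow> x \<in> A \<Longrightarrow> y \<in> A \<Longrightarrow> \<not> R x y"
  by (auto simp: npairs_def opp_def)

text \<open>A vertex with a single non-neighbour gives a suspension over its link. If there is none,
  some vertex \<open>v\<close> has exactly two non-neighbours; it lies on a pentagon, and what
  remains is the link of an edge at \<open>v\<close>, again extremal.\<close>

theorem extremal_decomposes: "extremal d V \<Longrightarrow> \<exists>m l. decomposes m l V"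
proof (induction d arbitrary: V rule: less_induct)
  case (less d)
  have pm: "pseudomanifold d V" using less.prems by (simp add: extremal_def)
  have fin: "finite V" using pm by (rule pseudomanifoldD)
  have finopp: "finite (opp V v)" for v using fin by (simp add: opp_def)
  have finL: "finite (nbh V v)" for v using fin by (simp add: nbh_def)
  have finoL: "finite (opp (nbh V v) u)" for u v using finL by (simp add: opp_def)
  consider "V = {}" | v where "v \<in> V" "card (opp V v) = 1"
    | v where "v \<in> V" "\<And>v. v \<in> V \<Longrightarrow> card (opp V v) \<noteq> 1"
    by blast
  then show ?case
  proof cases
    case 1 then show ?thesis using decomposes.empty by blast
  next
    case (2 v)
    obtain e where e: "d = Suc e" "extremal e (nbh V v)"
        "(\<Sum>u\<in>opp V v. card (opp (nbh V v) u)) + 2 = 2 * card (opp V v)"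
      using extremal_nbh[OF less.prems 2(1)] by metis
    obtain u where u: "opp V v = {u}" using 2(2) by (auto simp: card_1_singleton_iff)
    \<comment> \<open>Here the equality reads \<open>card (opp (nbh V v) u) + 2 = 2\<close>.\<close>
    with e(3) have "opp (nbh V v) u = {}" using finoL by auto
    then have nR: "\<not> R u x" if "x \<in> nbh V v" for x using that by (auto simp: opp_def)
    obtain m l where "decomposes m l (nbh V v)" using less.IH[OF _ e(2)] e(1) by blast
    moreover have "R v u" "u \<noteq> v" using u R_irrefl by (auto simp: opp_def)
    ultimately have "decomposes (Suc m) l (nbh V v \<union> {v, u})"
      using nR by (intro decomposes.suspension) (auto simp: nbh_def)
    moreover have "nbh V v \<union> {v, u} = V" using vertex_decomposition(1)[OF 2(1)] u by auto
    ultimately show ?thesis by metis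
  next
    case (3 v0)
    \<comment> \<open>By extremality the members of \<open>opp V v\<close> are pairwise compatible.
      A \<open>u\<close> compatible with the whole link would thus have \<open>v\<close> as its only
      non-neighbour, which this case excludes.\<close>
    have opp0: "opp (nbh V v) u \<noteq> {}" if v: "v \<in> V" and u: "u \<in> opp V v" for u v
    proof
      assume 0: "opp (nbh V v) u = {}"
      have "npairs (opp V v) = 0" using extremal_nbh[OF less.prems v] by metis
      then have "\<not> R u x" if "x \<in> opp V v" for x using npairs_0[OF finopp] that u by blast
      then have "opp V u = {v}"
        using 0 u v R_sym by (auto simp: opp_def nbh_def)
      then show False using 3(2)[of u] u by (simp add: opp_def)
    qed
    \<comment> \<open>The average of \<open>card (opp (nbh V v0) u)\<close> over
      \<open>opp V v0\<close> is below 2, so some \<open>u\<close> has exactly one non-neighbour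
      \<open>w\<close> in the link of \<open>v0\<close>. This \<open>u\<close>, whose non-neighbours
      are \<open>v0\<close> and \<open>w\<close>, becomes the new \<open>v\<close>.\<close>
    obtain v where v: "v \<in> V" "card (opp V v) = 2"
    proof -
      have e: "(\<Sum>u\<in>opp V v0. card (opp (nbh V v0) u)) + 2 = 2 * card (opp V v0)"
          "npairs (opp V v0) = 0"
        using extremal_nbh[OF less.prems 3(1)] by metis+
      have "\<exists>u\<in>opp V v0. card (opp (nbh V v0) u) < 2"
      proof (rule ccontr)
        assume "\<not> ?thesis"
        then have "(\<Sum>u\<in>opp V v0. 2) \<le> (\<Sum>u\<in>opp V v0. card (opp (nbh V v0) u))"
          by (intro sum_mono) auto
        with e(1) show False by simp
      qed
      then obtain u where u: "u \<in> opp V v0" "card (opp (nbh V v0) u) < 2" by blast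
      then have "card (opp (nbh V v0) u) = 1"
        using opp0[OF 3(1) u(1)] finoL[of v0 u] by (auto dest: less_2_cases)
      then obtain w where w: "opp (nbh V v0) u = {w}" by (auto simp: card_1_singleton_iff)
      have "\<not> R u x" if "x \<in> opp V v0" for x using npairs_0[OF finopp e(2)] that u by blast
      then have "opp V u = {v0, w}"
        using w u 3(1) R_sym by (auto simp: opp_def nbh_def)
      moreover have "v0 \<noteq> w" using w by (auto simp: opp_def nbh_def)
      ultimately show thesis using that[of u] u by (simp add: opp_def)
    qed
    let ?L = "nbh V v"
    obtain e where e: "d = Suc e" "extremal e ?L"
        "(\<Sum>u\<in>opp V v. card (opp ?L u)) + 2 = 2 * card (opp V v)" "npairs (opp V v) = 0"
      using extremal_nbh[OF less.prems v(1)] by metis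
    obtain u1 u2 where u: "opp V v = {u1, u2}" "u1 \<noteq> u2" using v(2) by (auto simp: card_2_iff)
    have uU: "u1 \<in> opp V v" "u2 \<in> opp V v" using u by auto
    have "card (opp ?L u1) \<noteq> 0" "card (opp ?L u2) \<noteq> 0"
      using opp0[OF v(1)] uU finoL by auto
    then have "card (opp ?L u1) = 1" "card (opp ?L u2) = 1" using e(3) v(2) u by auto
    then obtain w1 w2 where w: "opp ?L u1 = {w1}" "opp ?L u2 = {w2}"
      by (auto simp: card_1_singleton_iff)
    have pmL: "pseudomanifold e ?L" using e by (simp add: extremal_def)
    note pair = opp_card_1_pair[OF pm[unfolded e(1)] v(1) pmL uU u(2) w]
    note pair' = opp_card_1_pair[OF pm[unfolded e(1)] v(1) pmL uU(2,1) u(2)[symmetric] w(2,1)]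
    have wL: "w1 \<in> ?L" "w2 \<in> ?L" using w by (auto simp: opp_def)
    obtain e' where e': "e = Suc e'" "extremal e' (nbh ?L w1)" using extremal_nbh[OF e(2) wL(1)] .
    let ?M = "nbh ?L w1"
    \<comment> \<open>Inside the link of \<open>v\<close>, the only non-neighbour of
      \<open>w1\<close> is \<open>w2\<close>.\<close>
    have M: "?M = ?L - {w1, w2}" using pair pair' by (auto simp: nbh_def)
    obtain m l where ml: "decomposes m l ?M" using less.IH[OF _ e'(2)] e(1) e'(1) by auto
    \<comment> \<open>Cyclically consecutive entries are compatible and entries two apart are
      incompatible.\<close>
    define p where "p = (\<lambda>i::nat. [v, w1, u2, u1, w2] ! i)"
    have img: "p ` {..<5} = {v, w1, u2, u1, w2}"
      by (simp add: p_def lessThan_5)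
    have uL: "u1 \<notin> ?L" "u2 \<notin> ?L" "u1 \<noteq> v" "u2 \<noteq> v" "v \<notin> ?L"
      using vertex_decomposition[OF v(1)] uU by auto
    have dist: "distinct [v, w1, u2, u1, w2]" using u(2) uL wL pair(1) by auto
    have inj: "inj_on p {..<5}"
      using dist by (auto simp: p_def inj_on_def nth_eq_iff_index_eq)
    have vR: "R v u1" "R v u2" "\<not> R v w1" "\<not> R v w2"
      using u wL by (auto simp: opp_def nbh_def)
    have uw: "R u1 x \<longleftrightarrow> x = w1" "R u2 x \<longleftrightarrow> x = w2" if "x \<in> ?L" for x
      using w that by (auto simp: opp_def set_eq_iff)
    have uR: "\<not> R u1 u2" "R u1 w1" "R u2 w2" "\<not> R u1 w2" "\<not> R u2 w1"
      using npairs_0[OF finopp e(4)] uU uw wL pair(1) by auto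
    have "R u1 v" "R u2 v" "\<not> R w1 v" "\<not> R w2 v" "\<not> R u2 u1" "R w1 u1" "R w2 u2" "\<not> R w2 u1"
      "\<not> R w1 u2" "R w2 w1"
      using vR uR pair(2) R_sym by blast+
    note R' = this vR uR pair(2)
    have p: "p 0 = v" "p 1 = w1" "p 2 = u2" "p 3 = u1" "p 4 = w2" "p (Suc 0) = w1"
      by (simp_all add: p_def)
    have R5: "R (p i) (p j) \<longleftrightarrow> j = (i + 2) mod 5 \<or> i = (j + 2) mod 5"
      if "i < 5" "j < 5" for i j
    proof -
      have "i = 0 \<or> i = 1 \<or> i = 2 \<or> i = 3 \<or> i = 4" "j = 0 \<or> j = 1 \<or> j = 2 \<or> j = 3 \<or> j = 4"
        using that by auto
      then show ?thesis by (elim disjE) (simp_all add: p R' R_irrefl)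
    qed
    have none: "\<not> R (p i) x" if "i < 5" "x \<in> ?M" for i x
    proof -
      have "p i \<in> {v, w1, u2, u1, w2}" using that img by blast
      moreover have "x \<in> ?L" "x \<noteq> w1" "x \<noteq> w2" using that M by auto
      ultimately show ?thesis using pair(3) pair'(3) w by (auto simp: opp_def nbh_def)
    qed
    have "decomposes m (Suc l) (?M \<union> p ` {..<5})"
      by (rule decomposes.pentagon[OF ml inj _ R5 none]) (use M uL img in auto)
    moreover have "?M \<union> p ` {..<5} = V"
      using vertex_decomposition(1)[OF v(1)] M img u wL by auto
    ultimately show ?thesis by metis
  qed
qed

text \<open>A suspension pair contributes 2 ordered pairs and a pentagon 10, twice its five
  diagonals; distinct blocks are compatible with each other.\<close>

lemma decomposes_counts:
  "decomposes m l V \<Longrightarrow> finite V \<and> card V = 2 * m + 5 * l \<and> npairs V = 2 * m + 10 * l"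
proof (induction rule: decomposes.induct)
  case empty
  then show ?case by (simp add: npairs_def)
next
  case (suspension m l V a b)
  have "opp {a, b} a = {b}" "opp {a, b} b = {a}"
    using suspension R_irrefl R_sym by (auto simp: opp_def)
  then have "npairs {a, b} = 2" using suspension by (simp add: npairs_def)
  moreover have "opp {a, b} x = {}" if "x \<in> V" for x
    using suspension that R_sym by (auto simp: opp_def)
  ultimately show ?case
    using suspension npairs_Un[of V "{a, b}"] by simp
next
  case (pentagon m l V p)
  let ?C = "p ` {..<5}"
  have cC: "card ?C = 5" using pentagon by (simp add: card_image)
  have "card (opp ?C (p i)) = 2" if "i < 5" for i
  proof -
    have "opp ?C (p i) = p ` {j \<in> {..<5}. j = (i + 2) mod 5 \<or> i = (j + 2) mod 5}"
      using pentagon(4) that by (auto simp: opp_def)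
    moreover have "{j \<in> {..<5}. j = (i + 2) mod 5 \<or> i = (j + 2) mod 5} = {(i + 2) mod 5, (i + 3) mod 5}"
      by (rule pentagon_opposite[OF that])
    moreover have "inj_on p {(i + 2) mod 5, (i + 3) mod 5}"
      by (rule inj_on_subset[OF pentagon(2)]) auto
    moreover have "(i + 2) mod 5 \<noteq> (i + 3) mod 5"
    proof -
      have "i = 0 \<or> i = 1 \<or> i = 2 \<or> i = 3 \<or> i = 4" using that by auto
      then show ?thesis by (elim disjE) simp_all
    qed
    ultimately show ?thesis by (simp add: card_image)
  qed
  then have "npairs ?C = 10" using pentagon cC by (simp add: npairs_def sum.reindex)
  moreover have "opp ?C x = {}" if "x \<in> V" for x
    using pentagon(5) that R_sym by (fastforce simp: opp_def)
  ultimately show ?case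
    using pentagon npairs_Un[of V ?C] cC by (simp add: card_Un_disjoint Int_commute)
qed

end

section \<open>Joins of 5-cycles and their suspensions\<close>

lemma join_independent_sets:
  assumes "\<And>x y. x \<in> A \<Longrightarrow> y \<in> B \<Longrightarrow> \<not> R x y \<and> \<not> R y x"
  shows "join (independent_sets R A) (independent_sets R B) = independent_sets R (A \<union> B)"
proof (intro equalityI subsetI)
  fix \<sigma> assume "\<sigma> \<in> join (independent_sets R A) (independent_sets R B)"
  then show "\<sigma> \<in> independent_sets R (A \<union> B)"
    using assms unfolding join_def independent_sets_def by blast
next
  fix \<sigma> assume s: "\<sigma> \<in> independent_sets R (A \<union> B)"
  then have "\<sigma> = (\<sigma> \<inter> A) \<union> (\<sigma> \<inter> B)" by (auto simp: independent_sets_def)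
  moreover have "\<sigma> \<inter> A \<in> independent_sets R A" "\<sigma> \<inter> B \<in> independent_sets R B"
    using s by (auto simp: independent_sets_def)
  ultimately show "\<sigma> \<in> join (independent_sets R A) (independent_sets R B)"
    unfolding join_def by blast
qed

lemma relabel_independent_sets:
  assumes "\<And>x y. x \<in> V \<Longrightarrow> y \<in> V \<Longrightarrow> S (\<phi> x) (\<phi> y) \<longleftrightarrow> R x y"
  shows "relabel \<phi> (independent_sets R V) = independent_sets S (\<phi> ` V)"
proof (intro equalityI subsetI)
  fix \<sigma> assume "\<sigma> \<in> relabel \<phi> (independent_sets R V)"
  then show "\<sigma> \<in> independent_sets S (\<phi> ` V)"
    using assms unfolding relabel_def independent_sets_def by auto blast
next
  fix \<sigma> assume s: "\<sigma> \<in> independent_sets S (\<phi> ` V)"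
  have "\<sigma> = \<phi> ` {x \<in> V. \<phi> x \<in> \<sigma>}" using s by (auto simp: independent_sets_def)
  moreover have "{x \<in> V. \<phi> x \<in> \<sigma>} \<in> independent_sets R V"
    using s unfolding independent_sets_def by (auto simp flip: assms)
  ultimately show "\<sigma> \<in> relabel \<phi> (independent_sets R V)" unfolding relabel_def by blast
qed

context incompatibility begin

lemma vertices_indep: "vertices (indep V) = V"
proof -
  have "{x} \<in> indep V" if "x \<in> V" for x using that R_irrefl by (auto simp: independent_sets_def)
  then show ?thesis unfolding vertices_def by (auto simp: independent_sets_def)
qed

text \<open>Every ordered pair of distinct vertices is either an edge or a non-adjacent pair. A new
  vertex \<open>x\<close> is joined to \<open>nbh V x\<close> and separated from
  \<open>opp V x\<close>.\<close>

lemma f_number_2_indep: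
  "finite V \<Longrightarrow> 2 * f_number (indep V) 2 + npairs V = card V * (card V - 1)"
proof (induction rule: finite_induct)
  case empty
  have "{\<sigma> \<in> indep {}. card \<sigma> = 2} = {}" by (auto simp: independent_sets_def)
  then show ?case by (simp only: f_number_def npairs_def) simp
next
  case (insert x V)
  let ?F = "\<lambda>V. {\<sigma> \<in> indep V. card \<sigma> = 2}"
  have nbh: "nbh V x = V - opp V x" using insert by (auto simp: nbh_def opp_def)
  have "finite (?F V)" by (rule finite_subset[of _ "Pow V"]) (use insert in \<open>auto simp: independent_sets_def\<close>)
  moreover have F: "?F (insert x V) = ?F V \<union> (\<lambda>y. {x, y}) ` nbh V x"
  proof (intro equalityI subsetI)
    fix \<sigma> assume "\<sigma> \<in> ?F (insert x V)"
    then show "\<sigma> \<in> ?F V \<union> (\<lambda>y. {x, y}) ` nbh V x"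
      by (cases "x \<in> \<sigma>") (auto simp: independent_sets_def card_2_iff nbh_def)
  next
    fix \<sigma> assume "\<sigma> \<in> ?F V \<union> (\<lambda>y. {x, y}) ` nbh V x"
    then show "\<sigma> \<in> ?F (insert x V)"
      using insert(2) R_irrefl by (auto simp: independent_sets_def nbh_def card_insert_if dest: R_sym)
  qed
  moreover have "?F V \<inter> (\<lambda>y. {x, y}) ` nbh V x = {}"
    using insert(2) by (auto simp: independent_sets_def)
  moreover have "inj_on (\<lambda>y. {x, y}) (nbh V x)"
    by (auto simp: inj_on_def doubleton_eq_iff nbh_def)
  ultimately have "f_number (indep (insert x V)) 2 = f_number (indep V) 2 + card (nbh V x)"
    using insert(1) nbh by (simp add: f_number_def card_Un_disjoint card_image)
  moreover have "card (nbh V x) + card (opp V x) = card V"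
  proof -
    have "opp V x \<subseteq> V" by (auto simp: opp_def)
    then show ?thesis
      using insert(1) nbh by (metis card_Diff_subset card_mono finite_subset le_add_diff_inverse2)
  qed
  moreover have "npairs (insert x V) = npairs V + 2 * card (opp V x)"
    using npairs_Un[of "{x}" V] insert R_irrefl by (simp add: npairs_def opp_def)
  ultimately have "2 * f_number (indep (insert x V)) 2 + npairs (insert x V)
      = card V * (card V - 1) + 2 * card V"
    using insert.IH by simp
  also have "\<dots> = card (insert x V) * (card (insert x V) - 1)"
    using insert(1,2) by (cases "card V") (simp_all add: algebra_simps)
  finally show ?case .
qed

end

section \<open>The model complex and its non-adjacency relation\<close>

text \<open>The tags are those of \<open>iterated_join\<close> and
  \<open>iterated_suspension\<close>: non-adjacent are vertices two apart in one copy of the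
  pentagon, and the two points of one suspension step.\<close>

definition model_incompatible :: "nat \<times> nat + nat \<times> bool \<Rightarrow> nat \<times> nat + nat \<times> bool \<Rightarrow> bool" where
  "model_incompatible x y \<longleftrightarrow>
     (\<exists>j a b. x = Inl (j, a) \<and> y = Inl (j, b) \<and> (b = (a + 2) mod 5 \<or> a = (b + 2) mod 5)) \<or>
     (\<exists>k a b. x = Inr (k, a) \<and> y = Inr (k, b) \<and> a \<noteq> b)"

definition model_vertices :: "nat \<Rightarrow> nat \<Rightarrow> (nat \<times> nat + nat \<times> bool) set" where
  "model_vertices m l = Inl ` ({..<l} \<times> {..<5}) \<union> Inr ` ({..<m} \<times> UNIV)"

lemma model_incompatible_simps:
  "model_incompatible (Inl (j, a)) (Inl (k, b)) \<longleftrightarrow>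
     j = k \<and> (b = (a + 2) mod 5 \<or> a = (b + 2) mod 5)"
  "model_incompatible (Inr (j, c)) (Inr (k, e)) \<longleftrightarrow> j = k \<and> c \<noteq> e"
  "\<not> model_incompatible (Inl p) (Inr q)" "\<not> model_incompatible (Inr q) (Inl p)"
  by (auto simp: model_incompatible_def)

lemma cycle5_eq: "cycle5 = independent_sets (\<lambda>a b. b = (a + 2) mod 5 \<or> a = (b + 2) mod 5) {..<5}"
  (is "_ = independent_sets ?R _")
proof (rule set_eqI)
  fix \<sigma> :: "nat set"
  have ex: "(\<exists>i<5. P i) \<longleftrightarrow> P 0 \<or> P 1 \<or> P 2 \<or> P 3 \<or> P (4::nat)" for P
  proof -
    have "(\<exists>i<5. P i) \<longleftrightarrow> (\<exists>i\<in>{..<5}. P i)" by auto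
    then show ?thesis unfolding lessThan_5 by simp
  qed
  have "\<sigma> \<in> cycle5 \<longleftrightarrow> \<sigma> = {} \<or> (\<exists>i<5. \<sigma> = {i}) \<or> (\<exists>i<5. \<sigma> = {i, (i + 1) mod 5})"
    unfolding cycle5_def by blast
  also have "\<dots> \<longleftrightarrow> \<sigma> = {} \<or> (\<sigma> = {0} \<or> \<sigma> = {1} \<or> \<sigma> = {2} \<or> \<sigma> = {3} \<or> \<sigma> = {4}) \<or>
    (\<sigma> = {0, 1} \<or> \<sigma> = {1, 2} \<or> \<sigma> = {2, 3} \<or> \<sigma> = {3, 4} \<or> \<sigma> = {4, 0})"
  proof -
    have "(0 + 1) mod 5 = (1::nat)" "(1 + 1) mod 5 = (2::nat)" "(2 + 1) mod 5 = (3::nat)"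
      "(3 + 1) mod 5 = (4::nat)" "(4 + 1) mod 5 = (0::nat)" by simp_all
    then show ?thesis by (simp only: ex)
  qed
  finally have c5: "\<sigma> \<in> cycle5 \<longleftrightarrow> \<dots>" .
  show "\<sigma> \<in> cycle5 \<longleftrightarrow> \<sigma> \<in> independent_sets ?R {..<5}"
  proof
    assume "\<sigma> \<in> cycle5"
    then show "\<sigma> \<in> independent_sets ?R {..<5}"
      unfolding c5 by (elim disjE) (simp_all add: independent_sets_def)
  next
    assume s: "\<sigma> \<in> independent_sets ?R {..<5}"
    then have R: "\<not> ?R x y" if "x \<in> \<sigma>" "y \<in> \<sigma>" for x y
      using that unfolding independent_sets_def by blast
    have no: "\<not> (0 \<in> \<sigma> \<and> 2 \<in> \<sigma>)" "\<not> (1 \<in> \<sigma> \<and> 3 \<in> \<sigma>)" "\<not> (2 \<in> \<sigma> \<and> 4 \<in> \<sigma>)"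
        "\<not> (3 \<in> \<sigma> \<and> 0 \<in> \<sigma>)" "\<not> (4 \<in> \<sigma> \<and> 1 \<in> \<sigma>)"
      using R[of 0 2] R[of 1 3] R[of 2 4] R[of 3 0] R[of 4 1] by auto
    have sub: "x = 0 \<or> x = 1 \<or> x = 2 \<or> x = 3 \<or> x = 4" if "x \<in> \<sigma>" for x
      using s that by (auto simp: independent_sets_def)
    \<comment> \<open>Two consecutive vertices of the pentagon exclude the other three by
      \<open>no\<close>; the same reasoning is repeated for each edge.\<close>
    have p01: "\<sigma> = {0, 1}" if "0 \<in> \<sigma>" "1 \<in> \<sigma>"
    proof (rule equalityI[OF subsetI])
      show "x \<in> {0, 1}" if "x \<in> \<sigma>" for x
        using sub[OF that] no \<open>0 \<in> \<sigma>\<close> \<open>1 \<in> \<sigma>\<close> that by (elim disjE) simp_all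
    qed (use that in simp)
    have p12: "\<sigma> = {1, 2}" if "1 \<in> \<sigma>" "2 \<in> \<sigma>"
    proof (rule equalityI[OF subsetI])
      show "x \<in> {1, 2}" if "x \<in> \<sigma>" for x
        using sub[OF that] no \<open>1 \<in> \<sigma>\<close> \<open>2 \<in> \<sigma>\<close> that by (elim disjE) simp_all
    qed (use that in simp)
    have p23: "\<sigma> = {2, 3}" if "2 \<in> \<sigma>" "3 \<in> \<sigma>"
    proof (rule equalityI[OF subsetI])
      show "x \<in> {2, 3}" if "x \<in> \<sigma>" for x
        using sub[OF that] no \<open>2 \<in> \<sigma>\<close> \<open>3 \<in> \<sigma>\<close> that by (elim disjE) simp_all
    qed (use that in simp)
    have p34: "\<sigma> = {3, 4}" if "3 \<in> \<sigma>" "4 \<in> \<sigma>"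
    proof (rule equalityI[OF subsetI])
      show "x \<in> {3, 4}" if "x \<in> \<sigma>" for x
        using sub[OF that] no \<open>3 \<in> \<sigma>\<close> \<open>4 \<in> \<sigma>\<close> that by (elim disjE) simp_all
    qed (use that in simp)
    have p40: "\<sigma> = {4, 0}" if "4 \<in> \<sigma>" "0 \<in> \<sigma>"
    proof (rule equalityI[OF subsetI])
      show "x \<in> {4, 0}" if "x \<in> \<sigma>" for x
        using sub[OF that] no \<open>4 \<in> \<sigma>\<close> \<open>0 \<in> \<sigma>\<close> that by (elim disjE) simp_all
    qed (use that in simp)
    show "\<sigma> \<in> cycle5"
    proof (rule ccontr)
      assume n: "\<sigma> \<notin> cycle5"
      then have "\<sigma> \<noteq> {}" unfolding c5 by simp
      then obtain x where x: "x \<in> \<sigma>" by blast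
      have np: "\<not> (0 \<in> \<sigma> \<and> 1 \<in> \<sigma>)" "\<not> (1 \<in> \<sigma> \<and> 2 \<in> \<sigma>)" "\<not> (2 \<in> \<sigma> \<and> 3 \<in> \<sigma>)"
          "\<not> (3 \<in> \<sigma> \<and> 4 \<in> \<sigma>)" "\<not> (4 \<in> \<sigma> \<and> 0 \<in> \<sigma>)"
        using n p01 p12 p23 p34 p40 unfolding c5 by satx+
      have "y = x" if "y \<in> \<sigma>" for y
        using sub[OF that] sub[OF x] that x np no by (elim disjE) simp_all
      then have "\<sigma> = {x}" using x by blast
      with sub[OF x] have "\<sigma> = {0} \<or> \<sigma> = {1} \<or> \<sigma> = {2} \<or> \<sigma> = {3} \<or> \<sigma> = {4}"
        by (elim disjE) simp_all
      with n show False unfolding c5 by satx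
    qed
  qed
qed

text \<open>Every join adds a block of vertices compatible with all earlier ones, so
  \<open>join_independent_sets\<close> merges the vertex sets.\<close>

lemma model_eq:
  "iterated_suspension m (iterated_join l cycle5) = independent_sets model_incompatible (model_vertices m l)"
proof (induction m)
  case 0
  \<comment> \<open>The join lives on pairs, before \<open>Inl\<close> is applied; \<open>S\<close>
    is the non-adjacency relation pulled back to that type.\<close>
  define S where "S = (\<lambda>x y. model_incompatible (Inl x) (Inl y))"
  have "iterated_join l cycle5 = independent_sets S ({..<l} \<times> {..<5})"
  proof (induction l)
    case 0
    then show ?case by (auto simp: independent_sets_def)
  next
    case (Suc l)
    have "relabel (Pair l) cycle5 = independent_sets S (Pair l ` {..<5})"
      unfolding cycle5_eq
      by (rule relabel_independent_sets) (simp add: S_def model_incompatible_simps)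
    moreover have "join (independent_sets S ({..<l} \<times> {..<5})) (independent_sets S (Pair l ` {..<5}))
      = independent_sets S ({..<l} \<times> {..<5} \<union> Pair l ` {..<5})"
      by (rule join_independent_sets) (auto simp: S_def model_incompatible_simps)
    moreover have "{..<l} \<times> {..<5} \<union> Pair l ` {..<5::nat} = {..<Suc l} \<times> {..<5}"
      by (auto simp: less_Suc_eq)
    ultimately show ?case using Suc by simp
  qed
  then show ?case
    by (simp add: model_vertices_def S_def relabel_independent_sets[where S = model_incompatible])
next
  case (Suc m)
  let ?I = "\<lambda>b. Inr (m, b)"
  have sphere: "sphere0 = independent_sets (\<lambda>a b. a \<noteq> b) UNIV"
  proof (rule set_eqI)
    fix \<sigma> :: "bool set"
    show "\<sigma> \<in> sphere0 \<longleftrightarrow> \<sigma> \<in> independent_sets (\<lambda>a b. a \<noteq> b) UNIV"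
    proof -
      have "\<sigma> \<in> Pow {False, True}" by (auto simp flip: UNIV_bool)
      then have "\<sigma> = {} \<or> \<sigma> = {False} \<or> \<sigma> = {True} \<or> \<sigma> = {False, True}"
        by (auto simp: Pow_insert)
      then show ?thesis by (elim disjE) (auto simp: sphere0_def independent_sets_def doubleton_eq_iff)
    qed
  qed
  have "relabel ?I sphere0 = independent_sets model_incompatible (?I ` UNIV)"
    unfolding sphere by (rule relabel_independent_sets) (simp add: model_incompatible_simps)
  moreover have "join (independent_sets model_incompatible (?I ` UNIV))
      (independent_sets model_incompatible (model_vertices m l))
    = independent_sets model_incompatible (?I ` UNIV \<union> model_vertices m l)"
    by (rule join_independent_sets) (auto simp: model_vertices_def model_incompatible_simps)
  moreover have "?I ` UNIV \<union> model_vertices m l = model_vertices (Suc m) l"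
    by (auto simp: model_vertices_def less_Suc_eq)
  ultimately show ?case using Suc by simp
qed

interpretation model: incompatibility model_incompatible
proof
  fix x y
  show "model_incompatible y x" if "model_incompatible x y"
    using that by (auto simp: model_incompatible_def)
  have "a \<noteq> (a + 2) mod (5::nat)" for a
  proof
    assume a: "a = (a + 2) mod 5"
    then have "a < 5" by (metis mod_less_divisor zero_less_numeral)
    then have "a = 0 \<or> a = 1 \<or> a = 2 \<or> a = 3 \<or> a = 4" by auto
    with a show False by (elim disjE) simp_all
  qed
  then show "\<not> model_incompatible x x" by (auto simp: model_incompatible_def)
qed

text \<open>Through \<open>decomposes_counts\<close> this supplies the numbers of vertices and of
  non-adjacent pairs of the model.\<close>

lemma model_decomposes: "model.decomposes m l (model_vertices m l)"
proof (induction m)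
  case 0
  show ?case
  proof (induction l)
    case 0
    show ?case using model.decomposes.empty by (simp add: model_vertices_def)
  next
    case (Suc l)
    have "model.decomposes 0 (Suc l) (model_vertices 0 l \<union> (\<lambda>i. Inl (l, i)) ` {..<5})"
      by (rule model.decomposes.pentagon[OF Suc])
        (auto simp: model_vertices_def model_incompatible_simps inj_on_def)
    moreover have "model_vertices 0 l \<union> (\<lambda>i. Inl (l, i)) ` {..<5} = model_vertices 0 (Suc l)"
      by (auto simp: model_vertices_def less_Suc_eq)
    ultimately show ?case by simp
  qed
next
  case (Suc m)
  have "model.decomposes (Suc m) l (model_vertices m l \<union> {Inr (m, False), Inr (m, True)})"
    by (rule model.decomposes.suspension[OF Suc]) (auto simp: model_vertices_def model_incompatible_simps)
  moreover have "model_vertices m l \<union> {Inr (m, False), Inr (m, True)} = model_vertices (Suc m) l"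
    by (auto simp: model_vertices_def less_Suc_eq)
  ultimately show ?case by simp
qed

lemma (in incompatibility) decomposes_model:
  "decomposes m l V \<Longrightarrow> \<exists>\<phi>. bij_betw \<phi> V (model_vertices m l) \<and>
     (\<forall>x\<in>V. \<forall>y\<in>V. model_incompatible (\<phi> x) (\<phi> y) \<longleftrightarrow> R x y)"
proof (induction rule: decomposes.induct)
  case empty
  then show ?case by (auto simp: model_vertices_def bij_betw_def)
next
  case (suspension m l V a b)
  then obtain \<phi> where bij: "bij_betw \<phi> V (model_vertices m l)"
    and R: "\<And>x y. x \<in> V \<Longrightarrow> y \<in> V \<Longrightarrow> model_incompatible (\<phi> x) (\<phi> y) \<longleftrightarrow> R x y" by blast
  let ?\<psi> = "\<phi>(a := Inr (m, False), b := Inr (m, True))"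
  have \<psi>: "?\<psi> a = Inr (m, False)" "?\<psi> b = Inr (m, True)" "\<And>x. x \<in> V \<Longrightarrow> ?\<psi> x = \<phi> x"
    using suspension by auto
  have img: "\<phi> x \<in> model_vertices m l" if "x \<in> V" for x using bij that by (auto simp: bij_betw_def)
  have "bij_betw ?\<psi> V (model_vertices m l)"
    using bij \<psi>(3) by (simp cong: bij_betw_cong)
  moreover have "bij_betw ?\<psi> {a, b} {Inr (m, False), Inr (m, True)}"
    using suspension by (auto simp: bij_betw_def)
  ultimately have "bij_betw ?\<psi> (V \<union> {a, b}) (model_vertices m l \<union> {Inr (m, False), Inr (m, True)})"
    by (rule bij_betw_combine) (auto simp: model_vertices_def)
  moreover have "model_vertices m l \<union> {Inr (m, False), Inr (m, True)} = model_vertices (Suc m) l"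
    by (auto simp: model_vertices_def less_Suc_eq)
  moreover have "model_incompatible (?\<psi> x) (?\<psi> y) \<longleftrightarrow> R x y"
    if x: "x \<in> V \<union> {a, b}" and y: "y \<in> V \<union> {a, b}" for x y
  proof -
    have new: "\<not> model_incompatible (Inr (m, c)) (\<phi> z)" "\<not> model_incompatible (\<phi> z) (Inr (m, c))"
      if "z \<in> V" for z c
      using img[OF that] by (auto simp: model_vertices_def model_incompatible_simps)
    have nR: "\<not> R a z" "\<not> R b z" "\<not> R z a" "\<not> R z b" if "z \<in> V" for z
      using suspension(6)[OF that] R_sym by blast+
    have ab: "R a b" "R b a" using suspension(5) R_sym by auto
    consider "x \<in> V" | "x = a" | "x = b" using x by blast
    then show ?thesis
    proof cases
      case 1
      consider "y \<in> V" | "y = a" | "y = b" using y by blast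
      then show ?thesis by cases (simp_all only: \<psi> 1 R new nR)
    next
      case 2
      consider "y \<in> V" | "y = a" | "y = b" using y by blast
      then show ?thesis
        by cases (simp_all only: \<psi> 2 new nR ab R_irrefl model_incompatible_simps, simp_all)
    next
      case 3
      consider "y \<in> V" | "y = a" | "y = b" using y by blast
      then show ?thesis
        by cases (simp_all only: \<psi> 3 new nR ab R_irrefl model_incompatible_simps, simp_all)
    qed
  qed
  ultimately show ?case by metis
next
  case (pentagon m l V p)
  then obtain \<phi> where bij: "bij_betw \<phi> V (model_vertices m l)"
    and R: "\<And>x y. x \<in> V \<Longrightarrow> y \<in> V \<Longrightarrow> model_incompatible (\<phi> x) (\<phi> y) \<longleftrightarrow> R x y" by blast
  let ?I = "\<lambda>i. Inl (l, i)"
  let ?\<psi> = "\<lambda>x. if x \<in> V then \<phi> x else ?I (inv_into {..<5} p x)"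
  have pV: "p i \<notin> V" if "i < 5" for i using pentagon(3) that by blast
  have \<psi>: "\<And>i. i < 5 \<Longrightarrow> ?\<psi> (p i) = ?I i" "\<And>x. x \<in> V \<Longrightarrow> ?\<psi> x = \<phi> x"
    using pV pentagon(2) by auto
  have img: "\<phi> x \<in> model_vertices m l" if "x \<in> V" for x using bij that by (auto simp: bij_betw_def)
  have "bij_betw ?\<psi> V (model_vertices m l)"
    using bij by (simp cong: bij_betw_cong)
  moreover have "bij_betw ?\<psi> (p ` {..<5}) (?I ` {..<5})"
  proof (rule bij_betw_imageI)
    show "inj_on ?\<psi> (p ` {..<5})"
    proof (rule inj_onI)
      fix x y assume "x \<in> p ` {..<5}" "y \<in> p ` {..<5}" and e: "?\<psi> x = ?\<psi> y"
      then obtain i j where "i < 5" "j < 5" "x = p i" "y = p j" by auto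
      with e \<psi>(1) show "x = y" by (metis Inl_inject prod.inject)
    qed
    show "?\<psi> ` (p ` {..<5}) = ?I ` {..<5}"
      unfolding image_image by (rule image_cong[OF refl]) (use \<psi>(1) in auto)
  qed
  ultimately have b1: "bij_betw ?\<psi> (V \<union> p ` {..<5}) (model_vertices m l \<union> ?I ` {..<5})"
    by (rule bij_betw_combine) (auto simp: model_vertices_def)
  have b2: "model_vertices m l \<union> ?I ` {..<5} = model_vertices m (Suc l)"
    by (auto simp: model_vertices_def less_Suc_eq)
  have b3: "model_incompatible (?\<psi> x) (?\<psi> y) \<longleftrightarrow> R x y"
    if x: "x \<in> V \<union> p ` {..<5}" and y: "y \<in> V \<union> p ` {..<5}" for x y
  proof -
    have new: "\<not> model_incompatible (?I i) (\<phi> z)" "\<not> model_incompatible (\<phi> z) (?I i)"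
      if "z \<in> V" for z i
      using img[OF that] by (auto simp: model_vertices_def model_incompatible_simps)
    have nR: "\<not> R (p i) z" "\<not> R z (p i)" if "z \<in> V" "i < 5" for z i
      using pentagon(5)[OF that(2,1)] R_sym by blast+
    have y': "y \<in> V \<or> (\<exists>j<5. y = p j)" using y by blast
    consider "x \<in> V" | i where "i < 5" "x = p i" using x by blast
    then show ?thesis
    proof cases
      case 1
      from y' consider "y \<in> V" | j where "j < 5" "y = p j" by blast
      then show ?thesis
      proof cases
        case y: 1
        show ?thesis using R[OF 1 y] 1 y by simp
      next
        case (2 j)
        show ?thesis unfolding \<psi>(2)[OF 1] 2(2) \<psi>(1)[OF 2(1)] using new nR 1 2(1) by simp
      qed
    next
      case (2 i)
      from y' consider "y \<in> V" | j where "j < 5" "y = p j" by blast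
      then show ?thesis
      proof cases
        case y: 1
        show ?thesis unfolding \<psi>(2)[OF y] 2(2) \<psi>(1)[OF 2(1)] using new nR y 2(1) by simp
      next
        case (2 j)
        show ?thesis unfolding \<open>x = p i\<close> 2(2) \<psi>(1)[OF 2(1)] \<psi>(1)[OF \<open>i < 5\<close>]
          using pentagon(4)[OF \<open>i < 5\<close> 2(1)] by (simp add: model_incompatible_simps)
      qed
    qed
  qed
  show ?case using b1[unfolded b2] b3 by (intro exI[of _ ?\<psi>]) blast
qed

lemma f_number_iso:
  assumes "complex_iso \<Delta> \<Gamma>"
  shows "f_number \<Gamma> i = f_number \<Delta> i" "card (vertices \<Gamma>) = card (vertices \<Delta>)"
proof -
  obtain \<phi> where bij: "bij_betw \<phi> (vertices \<Delta>) (vertices \<Gamma>)" and G: "\<Gamma> = relabel \<phi> \<Delta>"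
    using assms by (auto simp: complex_iso_def)
  show "card (vertices \<Gamma>) = card (vertices \<Delta>)" using bij by (simp add: bij_betw_same_card)
  have inj: "inj_on \<phi> (\<Union>\<Delta>)" using bij by (simp add: bij_betw_def vertices_def)
  have c: "card (\<phi> ` \<sigma>) = card \<sigma>" if "\<sigma> \<in> \<Delta>" for \<sigma>
    by (rule card_image, rule inj_on_subset[OF inj]) (use that in auto)
  have "{\<tau> \<in> \<Gamma>. card \<tau> = i} = (`) \<phi> ` {\<sigma> \<in> \<Delta>. card \<sigma> = i}"
    using c by (auto simp: G relabel_def)
  moreover have "inj_on ((`) \<phi>) {\<sigma> \<in> \<Delta>. card \<sigma> = i}"
    by (rule inj_on_subset[OF inj_on_image[OF inj]]) auto
  ultimately show "f_number \<Gamma> i = f_number \<Delta> i" by (simp add: f_number_def card_image)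
qed

text \<open>Forwards, the decomposition is matched with the model. Backwards, an isomorphism
  preserves the numbers of vertices and edges, hence of non-adjacent pairs, and equality is checked
  on the model.\<close>

theorem (in incompatibility) extremal_iff_iso:
  assumes pm: "pseudomanifold d V" and n: "card V = 2 * d + l"
  shows "extremal d V \<longleftrightarrow>
    (\<exists>m. complex_iso (indep V) (iterated_suspension m (iterated_join l cycle5)))"
proof
  assume ex: "extremal d V"
  then obtain m l' where dec: "decomposes m l' V" using extremal_decomposes by blast
  note c = decomposes_counts[OF dec]
  \<comment> \<open>The counts turn equality into \<open>d = m + 2 * l'\<close>, so that
    \<open>card V - 2 * d = l'\<close>.\<close>
  have "l' = l" using c ex n by (simp add: extremal_def)
  then obtain \<phi> where \<phi>: "bij_betw \<phi> V (model_vertices m l)"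
      "\<And>x y. x \<in> V \<Longrightarrow> y \<in> V \<Longrightarrow> model_incompatible (\<phi> x) (\<phi> y) \<longleftrightarrow> R x y"
    using decomposes_model[OF dec] by blast
  have "complex_iso (indep V) (iterated_suspension m (iterated_join l cycle5))"
    unfolding complex_iso_def model_eq vertices_indep model.vertices_indep
    using \<phi> relabel_independent_sets[of V model_incompatible \<phi> R]
    by (auto simp: bij_betw_def)
  then show "\<exists>m. complex_iso (indep V) (iterated_suspension m (iterated_join l cycle5))" ..
next
  assume "\<exists>m. complex_iso (indep V) (iterated_suspension m (iterated_join l cycle5))"
  then obtain m where iso: "complex_iso (indep V) (independent_sets model_incompatible (model_vertices m l))"
    by (auto simp: model_eq)
  note c = model.decomposes_counts[OF model_decomposes[of m l]]
  have n': "card (model_vertices m l) = card V"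
    using f_number_iso(2)[OF iso] by (simp add: vertices_indep model.vertices_indep)
  have "2 * f_number (indep V) 2 + npairs V = card V * (card V - 1)"
    using pm by (intro f_number_2_indep) (simp add: pseudomanifold_def)
  moreover have "2 * f_number (indep V) 2 + model.npairs (model_vertices m l) = card V * (card V - 1)"
    using model.f_number_2_indep[of "model_vertices m l"] c n' f_number_iso(1)[OF iso] by simp
  ultimately have "npairs V = 2 * m + 10 * l" using c by simp
  \<comment> \<open>Comparing \<open>2 * m + 5 * l\<close> with \<open>2 * d + l\<close> gives
    \<open>d = m + 2 * l\<close>, and equality becomes arithmetic.\<close>
  then show "extremal d V" using pm n c n' by (simp add: extremal_def)
qed

section \<open>Dehn--Sommerville equations and the gamma-vector\<close>

lemma pcompose_power: "pcompose (p ^ n) q = pcompose p q ^ n"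
  for p :: "'a::comm_ring_1 poly"
  by (induction n) (simp_all add: pcompose_1 pcompose_mult)

definition f_poly :: "nat \<Rightarrow> 'a set set \<Rightarrow> int poly" where
  "f_poly d \<Delta> = (\<Sum>i=0..d. of_nat (f_number \<Delta> i) * [:0, 1:] ^ i)"

text \<open>The image of \<open>z ^ i (1 + z) ^ (d - 2 i)\<close> under the substitution that turns the h-polynomial
  into the f-polynomial.\<close>

definition gamma_term :: "nat \<Rightarrow> nat \<Rightarrow> int poly" where
  "gamma_term d i = [:0, 1, 1:] ^ i * [:1, 2:] ^ (d - 2 * i)"

definition gamma_expansion :: "nat \<Rightarrow> (nat \<Rightarrow> int) \<Rightarrow> int poly" where
  "gamma_expansion d \<gamma> = (\<Sum>i=0..d div 2. [:\<gamma> i:] * gamma_term d i)"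

lemma gamma_term_monom: "gamma_term d i = monom 1 i * ([:1, 1:] ^ i * [:1, 2:] ^ (d - 2 * i))"
proof -
  have e: "[:0, 1, 1:] = [:0, 1:] * [:1, 1 :: int:]" by simp
  show ?thesis
    unfolding gamma_term_def e power_mult_distrib monom_altdef by (simp add: mult.assoc)
qed

lemma coeff_0_power: "coeff (p ^ n) 0 = coeff p 0 ^ n" for p :: "'a::comm_ring_1 poly"
  by (simp flip: poly_0_coeff_0 add: poly_power)

lemma coeff_gamma_term:
  "n < i \<Longrightarrow> coeff (gamma_term d i) n = 0" "coeff (gamma_term d n) n = 1"
  by (simp_all add: gamma_term_monom coeff_monom_mult coeff_mult_0 coeff_0_power)

text \<open>The lowest term of \<open>gamma_term d i\<close> is the \<open>i\<close>-th power of the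
  variable with coefficient 1, so the system for the coefficients is triangular.\<close>

lemma gamma_expansion_eq_0:
  assumes "gamma_expansion d \<gamma> = 0" "i \<le> d div 2"
  shows "\<gamma> i = 0"
  using assms(2)
proof (induction i rule: less_induct)
  case (less n)
  have "0 = coeff (gamma_expansion d \<gamma>) n" using assms by simp
  also have "\<dots> = (\<Sum>i=0..d div 2. \<gamma> i * coeff (gamma_term d i) n)"
    by (simp add: gamma_expansion_def coeff_sum)
  also have "\<dots> = (\<Sum>i=0..d div 2. if i = n then \<gamma> n else 0)"
  proof (rule sum.cong[OF refl])
    fix i assume "i \<in> {0..d div 2}"
    then show "\<gamma> i * coeff (gamma_term d i) n = (if i = n then \<gamma> n else 0)"
      using less coeff_gamma_term by (cases i n rule: linorder_cases) auto
  qed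
  also have "\<dots> = \<gamma> n" using less by simp
  finally show ?case by simp
qed

lemma gamma_expansion_unique:
  assumes "gamma_expansion d \<gamma> = gamma_expansion d \<gamma>'"
    and "\<forall>j>d div 2. \<gamma> j = 0" "\<forall>j>d div 2. \<gamma>' j = 0"
  shows "\<gamma> = \<gamma>'"
proof
  fix i
  have "gamma_expansion d (\<lambda>i. \<gamma> i - \<gamma>' i)
      = (\<Sum>i=0..d div 2. [:\<gamma> i:] * gamma_term d i - [:\<gamma>' i:] * gamma_term d i)"
    unfolding gamma_expansion_def by (rule sum.cong[OF refl]) (simp add: smult_diff_left)
  also have "\<dots> = 0" using assms(1) by (simp add: gamma_expansion_def sum_subtractf)
  finally show "\<gamma> i = \<gamma>' i"
    using gamma_expansion_eq_0[of d "\<lambda>i. \<gamma> i - \<gamma>' i" i] assms(2,3) by (cases "i \<le> d div 2") auto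
qed

text \<open>Subtracting \<open>F(0) (1 + 2 x) ^ d\<close> leaves a polynomial that vanishes at 0 and, by symmetry, at -1;
  its quotient by \<open>x (1 + x)\<close> has the same symmetry in degree \<open>d - 2\<close>.\<close>

lemma gamma_expansion_exists:
  assumes "degree F \<le> d" and "pcompose F [:-1, -1:] = smult ((- 1) ^ d) F"
  shows "\<exists>\<gamma>. F = gamma_expansion d \<gamma> \<and> (\<forall>j>d div 2. \<gamma> j = 0)"
  using assms
proof (induction d arbitrary: F rule: less_induct)
  case (less d)
  consider "d = 0" | "d = 1" | e where "d = Suc (Suc e)" by (metis One_nat_def nat.exhaust)
  then show ?case
  proof cases
    case 1
    then obtain c where "F = [:c:]" using less.prems(1) by (auto elim: degree_eq_zeroE)
    with 1 show ?thesis
      by (intro exI[of _ "\<lambda>i. if i = 0 then c else 0"]) (simp add: gamma_expansion_def gamma_term_def)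
  next
    case 2
    define a b where "a = coeff F 0" and "b = coeff F 1"
    have F: "F = [:a, b:]"
    proof (rule poly_eqI)
      fix n show "coeff F n = coeff [:a, b:] n"
        using less.prems(1) 2
        by (cases "n > 1") (auto simp: coeff_eq_0 a_def b_def coeff_pCons split: nat.split)
    qed
    \<comment> \<open>Constant coefficients in the symmetry condition are compared; hence
      \<open>b = 2 * a\<close>.\<close>
    have "a - b = - a" using less.prems(2) 2 by (simp add: F pcompose_pCons)
    then have "F = [:a:] * [:1, 2:]" by (simp add: F)
    with 2 show ?thesis
      by (intro exI[of _ "\<lambda>i. if i = 0 then a else 0"]) (simp add: gamma_expansion_def gamma_term_def)
  next
    case (3 e)
    define c where "c = poly F 0"
    define G where "G = F - smult c ([:1, 2:] ^ d)"
    have m1: "poly F (-1) = (- 1) ^ d * c"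
    proof -
      have "poly F (-1) = poly (pcompose F [:-1, -1:]) 0" by (simp add: poly_pcompose)
      then show ?thesis using less.prems(2) by (simp add: c_def)
    qed
    have "poly G 0 = 0" by (simp add: G_def c_def poly_power)
    then obtain G1 where G1: "G = [:0, 1:] * G1" by (auto simp: poly_eq_0_iff_dvd dvd_def)
    have "poly G (-1) = 0" by (simp add: G_def m1 poly_power)
    then have "poly G1 (-1) = 0" by (simp add: G1)
    then obtain H where H: "G1 = [:1, 1:] * H" by (auto simp: poly_eq_0_iff_dvd dvd_def)
    have GH: "G = [:0, 1, 1:] * H" unfolding G1 H mult.assoc[symmetric] by simp
    have "degree G \<le> d" unfolding G_def
    proof (rule degree_diff_le[OF less.prems(1)])
      have "degree ([:1, 2:: int:] ^ d) \<le> 1 * d"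
        using degree_power_le[of "[:1, 2::int:]" d] by simp
      then show "degree (smult c ([:1, 2:] ^ d)) \<le> d"
        using degree_smult_le order_trans by fastforce
    qed
    then have "degree H \<le> e"
    proof (cases "H = 0")
      case False
      then have "degree G = 2 + degree H" unfolding GH by (subst degree_mult_eq) auto
      with \<open>degree G \<le> d\<close> 3 show ?thesis by simp
    qed simp
    moreover have "pcompose H [:-1, -1:] = smult ((- 1) ^ e) H"
    proof -
      have s: "[:0, 1, 1:] \<circ>\<^sub>p [:-1, -1:] = [:0, 1, 1 :: int:]" by (simp add: pcompose_pCons)
      have t: "[:1, 2:] \<circ>\<^sub>p [:-1, -1:] = - [:1, 2 :: int:]" by (simp add: pcompose_pCons)
      have "[:0, 1, 1:] * pcompose H [:-1, -1:] = pcompose G [:-1, -1:]"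
        unfolding GH pcompose_mult s ..
      also have "\<dots> = smult ((- 1) ^ d) F - smult c ((- [:1, 2:]) ^ d)"
        unfolding G_def pcompose_diff pcompose_smult pcompose_power t less.prems(2) ..
      also have "(- [:1, 2 :: int:]) ^ d = smult ((- 1) ^ d) ([:1, 2:] ^ d)"
        by (metis mult_minus1 mult_smult_left power_mult_distrib smult_1_left smult_minus_left smult_power)
      also have "smult ((- 1) ^ d) F - smult c (smult ((- 1) ^ d) ([:1, 2:] ^ d)) = smult ((- 1) ^ d) G"
        unfolding G_def smult_diff_right by (simp add: mult.commute)
      also have "\<dots> = [:0, 1, 1:] * smult ((- 1) ^ e) H"
        unfolding GH 3 by simp
      finally show ?thesis by (rule mult_left_cancel[THEN iffD1, rotated]) simp
    qed
    ultimately obtain \<gamma> where \<gamma>: "H = gamma_expansion e \<gamma>" "\<forall>j>e div 2. \<gamma> j = 0"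
      using less.IH[of e H] 3 by auto
    \<comment> \<open>Multiplication by \<open>[:0, 1, 1:]\<close> turns
      \<open>gamma_term e i\<close> into \<open>gamma_term d (Suc i)\<close>, so the coefficients of
      \<open>H\<close> move up by one place and \<open>c\<close> fills place 0.\<close>
    define \<gamma>' where "\<gamma>' = (\<lambda>i. case i of 0 \<Rightarrow> c | Suc i \<Rightarrow> \<gamma> i)"
    have d2: "d div 2 = Suc (e div 2)" using 3 by simp
    have "gamma_expansion d \<gamma>' = [:\<gamma>' 0:] * gamma_term d 0 +
        (\<Sum>i=0..e div 2. [:\<gamma>' (Suc i):] * gamma_term d (Suc i))"
      unfolding gamma_expansion_def d2 sum.atLeast0_atMost_Suc_shift o_def ..
    also have "\<dots> = smult c ([:1, 2:] ^ d) + [:0, 1, 1:] * gamma_expansion e \<gamma>"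
    proof (rule arg_cong2[where f = "(+)"])
      show "[:\<gamma>' 0:] * gamma_term d 0 = smult c ([:1, 2:] ^ d)"
        by (simp add: \<gamma>'_def gamma_term_def)
      have "gamma_term d (Suc i) = [:0, 1, 1:] * gamma_term e i" for i
        by (simp only: gamma_term_def 3 power_Suc mult.assoc) simp
      then show "(\<Sum>i=0..e div 2. [:\<gamma>' (Suc i):] * gamma_term d (Suc i))
          = [:0, 1, 1:] * gamma_expansion e \<gamma>"
        by (simp only: gamma_expansion_def sum_distrib_left \<gamma>'_def nat.case mult.left_commute)
    qed
    also have "\<dots> = F" using GH \<gamma>(1) by (simp add: G_def)
    finally have "F = gamma_expansion d \<gamma>'" ..
    moreover have "\<forall>j>d div 2. \<gamma>' j = 0"
      using \<gamma>(2) 3 by (auto simp: \<gamma>'_def split: nat.split)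
    ultimately show ?thesis by blast
  qed
qed

section \<open>Reversal of polynomials, linking the h-polynomial and the f-polynomial\<close>

text \<open>\<open>reflect_poly\<close> reverses with respect to the degree of the polynomial
  itself; fixing \<open>d\<close> instead makes reversal linear.\<close>

definition poly_reversal :: "nat \<Rightarrow> int poly \<Rightarrow> int poly" where
  "poly_reversal d p = (\<Sum>i=0..d. monom (coeff p i) (d - i))"

lemma coeff_poly_reversal: "coeff (poly_reversal d p) n = (if n \<le> d then coeff p (d - n) else 0)"
proof -
  have "coeff (poly_reversal d p) n = (\<Sum>i=0..d. if d - i = n then coeff p i else 0)"
    by (simp add: poly_reversal_def coeff_sum)
  also have "\<dots> = (\<Sum>i=0..d. if i = d - n \<and> n \<le> d then coeff p (d - n) else 0)"
    by (rule sum.cong) auto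
  finally show ?thesis by auto
qed

lemma poly_reversal_inject:
  assumes "degree p \<le> d" "degree q \<le> d" "poly_reversal d p = poly_reversal d q"
  shows "p = q"
proof (rule poly_eqI)
  fix n show "coeff p n = coeff q n"
    using assms(1,2) arg_cong[OF assms(3), of "\<lambda>r. coeff r (d - n)"]
    by (cases "n \<le> d") (simp_all add: coeff_poly_reversal coeff_eq_0)
qed

lemma degree_gamma_term: "2 * i \<le> d \<Longrightarrow> degree (gamma_term d i) = d"
  unfolding gamma_term_def by (subst degree_mult_eq) (simp_all add: degree_power_eq)

text \<open>The term has degree exactly \<open>d\<close>, so the reversal agrees with
  \<open>reflect_poly\<close>, which is multiplicative.\<close>

lemma reflect_gamma_term:
  "2 * i \<le> d \<Longrightarrow> poly_reversal d (gamma_term d i) = [:1, 1:] ^ i * [:2, 1:] ^ (d - 2 * i)"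
proof -
  assume "2 * i \<le> d"
  then have "poly_reversal d (gamma_term d i) = reflect_poly (gamma_term d i)"
    by (intro poly_eqI) (simp add: coeff_poly_reversal coeff_reflect_poly degree_gamma_term)
  moreover have "reflect_poly [:0, 1, 1 :: int:] = [:1, 1:]" "reflect_poly [:1, 2 :: int:] = [:2, 1:]"
    by (simp_all add: reflect_poly_def)
  ultimately show ?thesis
    by (simp add: gamma_term_def reflect_poly_mult reflect_poly_power)
qed

lemma poly_reversal_sum: "poly_reversal d (\<Sum>i\<in>A. f i) = (\<Sum>i\<in>A. poly_reversal d (f i))"
  by (intro poly_eqI) (simp add: coeff_poly_reversal coeff_sum)

lemma poly_reversal_smult: "poly_reversal d (smult c p) = smult c (poly_reversal d p)"
  by (intro poly_eqI) (simp add: coeff_poly_reversal)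

lemma coeff_f_poly: "coeff (f_poly d \<Delta>) n = (if n \<le> d then int (f_number \<Delta> n) else 0)"
  by (simp add: f_poly_def coeff_sum of_nat_poly flip: monom_altdef)

lemma degree_f_poly: "degree (f_poly d \<Delta>) \<le> d"
  by (rule degree_le) (simp add: coeff_f_poly)

lemma h_poly_pcompose: "pcompose (h_poly d \<Delta>) [:1, 1:] = poly_reversal d (f_poly d \<Delta>)"
proof -
  have 1: "[:-1, 1:] \<circ>\<^sub>p [:1, 1:] = [:0, 1 :: int:]" by (simp add: pcompose_pCons)
  have "pcompose (h_poly d \<Delta>) [:1, 1:] = (\<Sum>i=0..d. of_nat (f_number \<Delta> i) * [:0, 1:] ^ (d - i))"
    unfolding h_poly_def pcompose_sum pcompose_mult pcompose_power 1 of_nat_poly pcompose_const ..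
  also have "\<dots> = poly_reversal d (f_poly d \<Delta>)"
    unfolding poly_reversal_def
    by (rule sum.cong[OF refl]) (simp add: coeff_f_poly of_nat_poly monom_altdef)
  finally show ?thesis .
qed

text \<open>The substitution \<open>z = 1 + 1 / x\<close> turns \<open>h(z)\<close> into \<open>f(x) / x ^ d\<close> and \<open>z\<close>, \<open>1 + z\<close> into
  \<open>(1 + x) / x\<close>, \<open>(1 + 2 x) / x\<close>.\<close>

lemma h_poly_expansion_iff:
  "h_poly d \<Delta> = (\<Sum>i=0..d div 2. [:\<gamma> i:] * [:0, 1:] ^ i * [:1, 1:] ^ (d - 2 * i)) \<longleftrightarrow>
    f_poly d \<Delta> = gamma_expansion d \<gamma>"
  (is "_ = ?S \<longleftrightarrow> _")
proof -
  have "degree (gamma_expansion d \<gamma>) \<le> d"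
    unfolding gamma_expansion_def
  proof (rule degree_sum_le)
    fix i assume "i \<in> {0..d div 2}"
    then show "degree ([:\<gamma> i:] * gamma_term d i) \<le> d"
      using degree_smult_le[of "\<gamma> i" "gamma_term d i"] by (simp add: degree_gamma_term)
  qed simp
  have e: "[:0, 1:] \<circ>\<^sub>p [:1, 1:] = [:1, 1 :: int:]" "[:1, 1:] \<circ>\<^sub>p [:1, 1:] = [:2, 1 :: int:]"
    by (simp_all add: pcompose_pCons)
  have S: "pcompose ?S [:1, 1:] = poly_reversal d (gamma_expansion d \<gamma>)"
    unfolding pcompose_sum gamma_expansion_def poly_reversal_sum
  proof (rule sum.cong[OF refl])
    fix i assume "i \<in> {0..d div 2}"
    then have "2 * i \<le> d" by simp
    then show "([:\<gamma> i:] * [:0, 1:] ^ i * [:1, 1:] ^ (d - 2 * i)) \<circ>\<^sub>p [:1, 1:]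
      = poly_reversal d ([:\<gamma> i:] * gamma_term d i)"
      unfolding pcompose_mult pcompose_power e by (simp add: poly_reversal_smult reflect_gamma_term)
  qed
  have inj: "p = q" if "pcompose p [:1, 1:] = pcompose q [:1, 1:]" for p q :: "int poly"
  proof -
    have "pcompose r [:1, 1:] \<circ>\<^sub>p [:-1, 1:] = r" for r :: "int poly"
      by (simp add: pcompose_pCons flip: pcompose_assoc)
    then show ?thesis using that by metis
  qed
  have "h_poly d \<Delta> = ?S \<longleftrightarrow> pcompose (h_poly d \<Delta>) [:1, 1:] = pcompose ?S [:1, 1:]"
    by (rule iffI, simp only:, erule inj)
  also have "\<dots> \<longleftrightarrow> poly_reversal d (f_poly d \<Delta>) = poly_reversal d (gamma_expansion d \<gamma>)"
    unfolding S h_poly_pcompose ..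
  also have "\<dots> \<longleftrightarrow> f_poly d \<Delta> = gamma_expansion d \<gamma>"
    by (rule iffI, erule poly_reversal_inject[OF degree_f_poly \<open>degree (gamma_expansion d \<gamma>) \<le> d\<close>], simp only:)
  finally show ?thesis .
qed

section \<open>Dehn--Sommerville equations from Euler characteristics\<close>

text \<open>The sum is minus the reduced Euler characteristic of the link, prescribed to be that of
  a sphere of dimension \<open>d - card \<sigma> - 1\<close>.\<close>

definition eulerian_complex :: "nat \<Rightarrow> 'a set set \<Rightarrow> bool" where
  "eulerian_complex d \<Delta> \<longleftrightarrow> simplicial_complex \<Delta> \<and>
     (\<forall>\<sigma>\<in>\<Delta>. card \<sigma> \<le> d \<and> (\<Sum>\<tau>\<in>link \<Delta> \<sigma>. (- 1) ^ card \<tau>) = ((- 1) ^ (d - card \<sigma>) :: int))"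

lemma f_poly_eq_sum:
  assumes "eulerian_complex d \<Delta>"
  shows "f_poly d \<Delta> = (\<Sum>\<sigma>\<in>\<Delta>. [:0, 1:] ^ card \<sigma>)"
proof -
  have fin: "finite \<Delta>" using assms by (simp add: eulerian_complex_def simplicial_complex_def)
  have "(\<Sum>\<sigma>\<in>\<Delta>. [:0, 1:] ^ card \<sigma>) = (\<Sum>i=0..d. \<Sum>\<sigma> | \<sigma> \<in> \<Delta> \<and> card \<sigma> = i. [:0, 1 :: int:] ^ card \<sigma>)"
    by (rule sum.group[symmetric]) (use assms fin in \<open>auto simp: eulerian_complex_def\<close>)
  also have "\<dots> = f_poly d \<Delta>"
    unfolding f_poly_def f_number_def by (rule sum.cong) auto
  finally show ?thesis by simp
qed

lemma sum_link:
  assumes "simplicial_complex \<Delta>" "\<tau> \<in> \<Delta>"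
  shows "(\<Sum>\<sigma> | \<sigma> \<in> \<Delta> \<and> \<tau> \<subseteq> \<sigma>. g \<sigma>) = (\<Sum>\<rho>\<in>link \<Delta> \<tau>. g (\<rho> \<union> \<tau>))"
proof (rule sum.reindex_bij_witness[where i = "\<lambda>\<rho>. \<rho> \<union> \<tau>" and j = "\<lambda>\<sigma>. \<sigma> - \<tau>"])
  fix \<sigma> assume "\<sigma> \<in> {\<sigma> \<in> \<Delta>. \<tau> \<subseteq> \<sigma>}"
  then show "\<sigma> - \<tau> \<in> link \<Delta> \<tau>" "(\<sigma> - \<tau>) \<union> \<tau> = \<sigma>" "g ((\<sigma> - \<tau>) \<union> \<tau>) = g \<sigma>"
    using assms by (auto simp: link_def simplicial_complex_def Un_absorb2)
qed (auto simp: link_def)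

text \<open>The power of \<open>-(1 + x)\<close> belonging to a face is expanded over its subsets.
  After exchanging the sums, the coefficient of a face \<open>\<tau>\<close> is a signed sum over
  the faces containing \<open>\<tau>\<close>, given by the Euler characteristic of its link.\<close>

lemma f_poly_symmetry:
  assumes eu: "eulerian_complex d \<Delta>"
  shows "pcompose (f_poly d \<Delta>) [:-1, -1:] = smult ((- 1) ^ d) (f_poly d \<Delta>)"
proof -
  have sc: "simplicial_complex \<Delta>" using eu by (simp add: eulerian_complex_def)
  have fin: "finite \<Delta>" and fin': "\<And>\<sigma>. \<sigma> \<in> \<Delta> \<Longrightarrow> finite \<sigma>"
    using sc by (auto simp: simplicial_complex_def)
  have X: "[:0, 1:] \<circ>\<^sub>p [:-1, -1:] = [:-1 :: int:] * (1 + [:0, 1:])"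
    by (simp add: pcompose_pCons one_pCons)
  have binom: "(1 + [:0, 1 :: int:]) ^ card \<sigma> = (\<Sum>\<tau>\<in>Pow \<sigma>. [:0, 1:] ^ card \<tau>)" if "\<sigma> \<in> \<Delta>" for \<sigma>
  proof -
    have "(\<Prod>x\<in>\<sigma>. [:0, 1 :: int:] + 1) = (\<Sum>\<tau>\<in>Pow \<sigma>. (\<Prod>x\<in>\<tau>. [:0, 1:]) * (\<Prod>x\<in>\<sigma> - \<tau>. 1))"
      by (rule prod_add[OF fin'[OF that]])
    then show ?thesis by (simp add: add.commute)
  qed
  have "pcompose (f_poly d \<Delta>) [:-1, -1:] = (\<Sum>\<sigma>\<in>\<Delta>. [:-1:] ^ card \<sigma> * (1 + [:0, 1:]) ^ card \<sigma>)"
    unfolding f_poly_eq_sum[OF eu] pcompose_sum pcompose_power X power_mult_distrib ..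
  also have "\<dots> = (\<Sum>\<sigma>\<in>\<Delta>. \<Sum>\<tau> | \<tau> \<in> \<Delta> \<and> \<tau> \<subseteq> \<sigma>. [:-1:] ^ card \<sigma> * [:0, 1:] ^ card \<tau>)"
  proof (rule sum.cong[OF refl])
    fix \<sigma> assume s: "\<sigma> \<in> \<Delta>"
    have "{\<tau> \<in> \<Delta>. \<tau> \<subseteq> \<sigma>} = Pow \<sigma>" using s sc by (auto simp: simplicial_complex_def)
    then show "[:-1:] ^ card \<sigma> * (1 + [:0, 1:]) ^ card \<sigma>
      = (\<Sum>\<tau> | \<tau> \<in> \<Delta> \<and> \<tau> \<subseteq> \<sigma>. [:-1:] ^ card \<sigma> * [:0, 1 :: int:] ^ card \<tau>)"
      by (simp only: binom[OF s] sum_distrib_left)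
  qed
  also have "\<dots> = (\<Sum>\<tau>\<in>\<Delta>. \<Sum>\<sigma> | \<sigma> \<in> \<Delta> \<and> \<tau> \<subseteq> \<sigma>. [:-1:] ^ card \<sigma> * [:0, 1:] ^ card \<tau>)"
    by (rule sum.swap_restrict[OF fin fin])
  also have "\<dots> = (\<Sum>\<tau>\<in>\<Delta>. [:-1:] ^ d * [:0, 1:] ^ card \<tau>)"
  proof (rule sum.cong[OF refl])
    fix \<tau> assume t: "\<tau> \<in> \<Delta>"
    have "(\<Sum>\<sigma> | \<sigma> \<in> \<Delta> \<and> \<tau> \<subseteq> \<sigma>. (-1) ^ card \<sigma>) = (\<Sum>\<rho>\<in>link \<Delta> \<tau>. (-1) ^ card \<rho> * (-1 :: int) ^ card \<tau>)"
      unfolding sum_link[OF sc t]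
    proof (rule sum.cong[OF refl])
      fix \<rho> assume "\<rho> \<in> link \<Delta> \<tau>"
      then have "card (\<rho> \<union> \<tau>) = card \<rho> + card \<tau>"
        using fin' t by (intro card_Un_disjoint) (auto simp: link_def)
      then show "(-1 :: int) ^ card (\<rho> \<union> \<tau>) = (-1) ^ card \<rho> * (-1) ^ card \<tau>"
        by (simp add: power_add)
    qed
    also have "\<dots> = (-1) ^ (d - card \<tau>) * (-1) ^ card \<tau>"
      using eu t by (simp add: eulerian_complex_def flip: sum_distrib_right)
    also have "\<dots> = (-1) ^ d"
      using eu t by (simp add: eulerian_complex_def flip: power_add)
    finally have "(\<Sum>\<sigma> | \<sigma> \<in> \<Delta> \<and> \<tau> \<subseteq> \<sigma>. (-1 :: int) ^ card \<sigma>) = (-1) ^ d" .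
    then have "[:\<Sum>\<sigma> | \<sigma> \<in> \<Delta> \<and> \<tau> \<subseteq> \<sigma>. (-1 :: int) ^ card \<sigma>:] = [:(-1) ^ d:]" by simp
    then have "(\<Sum>\<sigma> | \<sigma> \<in> \<Delta> \<and> \<tau> \<subseteq> \<sigma>. [:-1 :: int:] ^ card \<sigma>) = [:-1:] ^ d"
      unfolding poly_const_pow sum_to_poly by simp
    then show "(\<Sum>\<sigma> | \<sigma> \<in> \<Delta> \<and> \<tau> \<subseteq> \<sigma>. [:-1:] ^ card \<sigma> * [:0, 1:] ^ card \<tau>)
      = [:-1:] ^ d * [:0, 1 :: int:] ^ card \<tau>"
      by (simp only: sum_distrib_right[symmetric])
  qed
  also have "\<dots> = smult ((- 1) ^ d) (f_poly d \<Delta>)"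
    unfolding f_poly_eq_sum[OF eu] sum_distrib_left[symmetric] by (simp add: poly_const_pow)
  finally show ?thesis .
qed

text \<open>Existence and uniqueness of the expansion make the definite description in
  \<open>gamma_vector\<close> denote.\<close>

lemma f_poly_gamma_vector:
  assumes "eulerian_complex d \<Delta>"
  shows "f_poly d \<Delta> = gamma_expansion d (gamma_vector d \<Delta>)" "j > d div 2 \<Longrightarrow> gamma_vector d \<Delta> j = 0"
proof -
  have "\<exists>!\<gamma>. f_poly d \<Delta> = gamma_expansion d \<gamma> \<and> (\<forall>j>d div 2. \<gamma> j = 0)"
  proof (rule ex_ex1I)
    show "\<exists>\<gamma>. f_poly d \<Delta> = gamma_expansion d \<gamma> \<and> (\<forall>j>d div 2. \<gamma> j = 0)"
      by (rule gamma_expansion_exists[OF degree_f_poly f_poly_symmetry[OF assms]])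
  qed (metis gamma_expansion_unique)
  from theI'[OF this] show "f_poly d \<Delta> = gamma_expansion d (gamma_vector d \<Delta>)"
      "j > d div 2 \<Longrightarrow> gamma_vector d \<Delta> j = 0"
    unfolding gamma_vector_def h_poly_expansion_iff by auto
qed

text \<open>The coefficients of degree 0, 1 and 2 of the gamma-expansion are read off in turn; they
  determine \<open>\<gamma> 0 = 1\<close>, then \<open>\<gamma> 1\<close>, then the formula.\<close>

theorem f_number_2_gamma:
  assumes "eulerian_complex d \<Delta>"
  shows "int (f_number \<Delta> 2) = 2 * int d * (int d - 1)
    + (int (f_number \<Delta> 1) - 2 * int d) * (2 * int d - 3) + gamma_vector d \<Delta> 2"
proof -
  define \<gamma> where "\<gamma> = gamma_vector d \<Delta>"
  have F: "f_poly d \<Delta> = gamma_expansion d \<gamma>" and \<gamma>0: "\<And>j. j > d div 2 \<Longrightarrow> \<gamma> j = 0"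
    using f_poly_gamma_vector[OF assms] by (auto simp: \<gamma>_def)
  have f0: "f_number \<Delta> 0 = 1"
  proof -
    have "{\<sigma> \<in> \<Delta>. card \<sigma> = 0} = {{}}"
      using assms by (auto simp: eulerian_complex_def simplicial_complex_def)
    then show ?thesis by (simp add: f_number_def)
  qed
  have fd: "f_number \<Delta> i = 0" if "i > d" for i
  proof -
    have "{\<sigma> \<in> \<Delta>. card \<sigma> = i} = {}" using that assms by (auto simp: eulerian_complex_def)
    then show ?thesis by (simp only: f_number_def) simp
  qed
  have f: "int (f_number \<Delta> n) = (\<Sum>i=0..d div 2. \<gamma> i * coeff (gamma_term d i) n)" for n
  proof -
    have "int (f_number \<Delta> n) = coeff (f_poly d \<Delta>) n" by (simp add: coeff_f_poly fd)
    then show ?thesis unfolding F by (simp add: gamma_expansion_def coeff_sum)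
  qed
  have lin: "coeff ([:1, c:] ^ k) 1 = int k * c" for k and c :: int
    using coeff_linear_poly_power[of 1 k 1 c] by (cases "k = 0") simp_all
  have c0: "coeff (gamma_term d i) 0 = (if i = 0 then 1 else 0)" for i
    using coeff_gamma_term by (cases i) auto
  have c1: "coeff (gamma_term d i) 1 = (if i = 0 then 2 * int d else if i = 1 then 1 else 0)" for i
    using coeff_gamma_term(1)[of 1 i d] coeff_gamma_term(2)[of d 1] lin[of 2 d]
    by (auto simp: gamma_term_def)
  \<comment> \<open>The truncated \<open>d - 2\<close> matters only for \<open>d < 2\<close>, where
    the expansion has no term with index 1.\<close>
  have c2: "coeff (gamma_term d i) 2 = (if i = 0 then 2 * int d * (int d - 1) else
      if i = 1 then 1 + 2 * int (d - 2) else if i = 2 then 1 else 0)" for i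
  proof -
    have "coeff (gamma_term d 0) 2 = 2 * int d * (int d - 1)"
    proof (cases "d \<ge> 2")
      case True
      then have "coeff (gamma_term d 0) 2 = int (d choose 2) * 4"
        by (simp add: gamma_term_def coeff_linear_poly_power)
      also have "int (d choose 2) * 4 = 2 * int (2 * (d choose 2))" by simp
      also have "2 * (d choose 2) = d * (d - 1)"
        unfolding choose_two by (rule dvd_mult_div_cancel) (cases d; simp)
      finally show ?thesis using True by (simp add: of_nat_diff)
    next
      case False
      then have "d = 0 \<or> d = 1" by auto
      then show ?thesis by (auto simp: gamma_term_def eval_nat_numeral)
    qed
    moreover have "coeff (gamma_term d 1) 2 = 1 + 2 * int (d - 2)"
    proof -
      have "coeff (gamma_term d 1) 2 = coeff ([:1, 1:] * [:1, 2:] ^ (d - 2)) 1"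
        by (simp add: gamma_term_monom coeff_monom_mult)
      also have "\<dots> = coeff ([:1, 2:] ^ (d - 2)) 1 + coeff ([:1, 2:] ^ (d - 2)) 0"
        by (simp add: coeff_pCons)
      finally show ?thesis using lin[of 2 "d - 2"] by (simp add: coeff_0_power)
    qed
    ultimately show ?thesis
      using coeff_gamma_term(1)[of 2 i d] coeff_gamma_term(2)[of d 2]
      by (cases "i > 2") (auto simp: not_less le_Suc_eq numeral_2_eq_2)
  qed
  have g0: "\<gamma> 0 = 1"
    using f[of 0] f0 by (simp add: c0 if_distrib cong: if_cong)
  \<comment> \<open>For small \<open>d\<close> the sum stops at \<open>d div 2\<close>. The formula
    persists because \<open>\<gamma> 2 = 0\<close> there, and for \<open>d \<le> 1\<close> also
    \<open>f_number \<Delta> 1 = 2 * d\<close>.\<close>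
  consider "d = 0 \<or> d = 1" | "d = 2 \<or> d = 3" | "d \<ge> 4" by linarith
  then show ?thesis
  proof cases
    case 1
    then have "d div 2 = 0" by auto
    then show ?thesis
      using f[of 1] f[of 2] g0 \<gamma>0[of 2] unfolding c1 c2 by (auto simp: \<gamma>_def)
  next
    case 2
    then have d1: "d div 2 = 1" by auto
    then have \<gamma>2: "\<gamma> 2 = 0" by (intro \<gamma>0) simp
    have 01: "{0..d div 2} = {0, 1}" unfolding d1 by auto
    have "int (f_number \<Delta> 1) = 2 * int d + \<gamma> 1"
      using f[of 1] g0 unfolding c1 01 by simp
    moreover have "int (f_number \<Delta> 2) = 2 * int d * (int d - 1) + \<gamma> 1 * (1 + 2 * int (d - 2))"
      using f[of 2] g0 unfolding c2 01 by simp
    ultimately show ?thesis using 2 \<gamma>2 by (elim disjE) (simp_all add: \<gamma>_def)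
  next
    case 3
    have d2: "(\<Sum>i=0..d div 2. g i) = g 0 + g 1 + g 2"
      if "\<And>i. i > 2 \<Longrightarrow> g i = 0" for g :: "nat \<Rightarrow> int"
    proof -
      have "(\<Sum>i=0..d div 2. g i) = (\<Sum>i\<in>{0, 1, 2}. g i)"
        by (rule sum.mono_neutral_right) (use 3 that in auto)
      then show ?thesis by simp
    qed
    have "int (f_number \<Delta> 1) = \<gamma> 0 * (2 * int d) + \<gamma> 1"
      using f[of 1] unfolding c1 by (subst (asm) d2) auto
    moreover have "int (f_number \<Delta> 2) = \<gamma> 0 * (2 * int d * (int d - 1)) + \<gamma> 1 * (1 + 2 * int (d - 2)) + \<gamma> 2"
      using f[of 2] unfolding c2 by (subst (asm) d2) auto
    ultimately show ?thesis
      using 3 g0 by (simp add: \<gamma>_def of_nat_diff algebra_simps)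
  qed
qed

section \<open>Euler characteristics of links in homology spheres\<close>

text \<open>Rank and nullity on a subspace: a basis \<open>A\<close> of the kernel is extended to a
  basis \<open>B\<close> of \<open>S\<close>, and \<open>f\<close> maps \<open>B - A\<close>
  injectively onto a basis of the image. Finiteness is asked of \<open>S\<close> alone because the
  ambient function space may be infinite-dimensional.\<close>

lemma (in Vector_Spaces.linear) dim_kernel_image:
  assumes S: "vs1.subspace S" and T: "finite T" "S \<subseteq> vs1.span T"
  shows "vs1.dim S = vs1.dim {x \<in> S. f x = 0} + vs2.dim (f ` S)"
proof -
  let ?K = "{x \<in> S. f x = 0}"
  obtain A where A: "A \<subseteq> ?K" "vs1.independent A" "?K \<subseteq> vs1.span A" "card A = vs1.dim ?K"
    by (rule vs1.basis_exists)
  have "A \<subseteq> S" using A(1) by blast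
  then obtain B where B: "A \<subseteq> B" "B \<subseteq> S" "vs1.independent B" "S \<subseteq> vs1.span B"
    using vs1.maximal_independent_subset_extend[OF _ A(2)] by blast
  have finB: "finite B" using vs1.independent_span_bound[OF T(1) B(3)] B(2) T(2) by blast
  let ?C = "B - A"
  have CS: "vs1.span ?C \<subseteq> S" by (rule vs1.span_minimal[OF _ S]) (use B in blast)
  \<comment> \<open>Such an \<open>x\<close> lies in the spans of two disjoint parts of the
    independent set \<open>B\<close>, so all its coordinates vanish.\<close>
  have ker: "x = 0" if x: "x \<in> vs1.span ?C" and fx: "f x = 0" for x
  proof -
    have xA: "x \<in> vs1.span A" using x CS fx A(3) by blast
    have "vs1.representation B x = vs1.representation ?C x"
      by (rule vs1.representation_extend[OF B(3) x]) blast
    moreover have "vs1.representation B x = vs1.representation A x"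
      by (rule vs1.representation_extend[OF B(3) xA B(1)])
    ultimately have "vs1.representation B x b = 0" for b
      using vs1.representation_ne_zero[of ?C x b] vs1.representation_ne_zero[of A x b] by auto
    moreover have "x \<in> vs1.span B" using xA B(1) vs1.span_mono by blast
    ultimately show "x = 0" using vs1.sum_nonzero_representation_eq[OF B(3), of x] by simp
  qed
  have inj: "inj_on f (vs1.span ?C)"
  proof (rule inj_onI)
    fix x y assume "x \<in> vs1.span ?C" "y \<in> vs1.span ?C" "f x = f y"
    then have "x - y = 0" by (intro ker) (auto simp: diff vs1.span_diff)
    then show "x = y" by simp
  qed
  have "vs1.independent ?C" by (rule vs1.independent_mono[OF B(3)]) blast
  then have ind: "vs2.independent (f ` ?C)"
    by (rule independent_injective_image[OF _ inj])
  have "f ` S \<subseteq> vs2.span (f ` ?C)"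
  proof
    fix y assume "y \<in> f ` S"
    then obtain x where x: "x \<in> S" "y = f x" by blast
    then have "x \<in> vs1.span B" using B by blast
    then have "y \<in> vs2.span (f ` B)" using x by (simp add: span_image)
    moreover have "f ` B \<subseteq> insert 0 (f ` ?C)" using A(1) by auto
    ultimately show "y \<in> vs2.span (f ` ?C)"
      using vs2.span_mono[of "f ` B" "insert 0 (f ` ?C)"] by auto
  qed
  then have "vs2.dim (f ` S) = card (f ` ?C)"
    using ind B(2) by (intro vs2.dim_unique[of "f ` ?C"]) auto
  also have "\<dots> = card ?C"
    by (rule card_image, rule inj_on_subset[OF inj]) (rule vs1.span_superset)
  finally have "vs2.dim (f ` S) = card ?C" .
  moreover have "vs1.dim S = card B" by (rule vs1.dim_unique[OF B(2,4,3)]) simp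
  moreover have "card B = card A + card ?C"
    using finB B(1) by (metis card_Diff_subset card_mono finite_subset le_add_diff_inverse)
  ultimately show ?thesis using A(4) by simp
qed

interpretation fun_space: vector_space "\<lambda>(a::'k::field) (c::'b \<Rightarrow> 'k) x. a * c x"
  by standard (auto simp: fun_eq_iff algebra_simps)

definition delta :: "'b \<Rightarrow> 'b \<Rightarrow> 'k::field" where
  "delta a = (\<lambda>x. if x = a then 1 else 0)"

lemma sum_fun_apply: "(\<Sum>i\<in>I. f i) x = (\<Sum>i\<in>I. f i x)"
  for f :: "'i \<Rightarrow> 'b \<Rightarrow> 'k::comm_monoid_add"
  by (induction I rule: infinite_finite_induct) auto

lemma delta_expansion:
  assumes "finite A" "\<And>x. c x \<noteq> 0 \<Longrightarrow> x \<in> A"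
  shows "c = (\<Sum>a\<in>A. (\<lambda>x. c a * delta a x))"
proof
  fix x
  have "(\<Sum>a\<in>A. (\<lambda>x. c a * delta a x)) x = (\<Sum>a\<in>A. if a = x then c x else 0)"
    unfolding sum_fun_apply by (rule sum.cong) (auto simp: delta_def)
  also have "\<dots> = c x" using assms by auto
  finally show "c x = (\<Sum>a\<in>A. (\<lambda>x. c a * delta a x)) x" ..
qed

lemma support_span:
  assumes "finite A"
  shows "{c :: 'b \<Rightarrow> 'k::field. \<forall>x. c x \<noteq> 0 \<longrightarrow> x \<in> A} \<subseteq> fun_space.span (delta ` A)"
proof
  fix c :: "'b \<Rightarrow> 'k" assume "c \<in> {c. \<forall>x. c x \<noteq> 0 \<longrightarrow> x \<in> A}"
  then have "c = (\<Sum>a\<in>A. (\<lambda>x. c a * delta a x))" using delta_expansion[OF assms] by blast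
  also have "\<dots> \<in> fun_space.span (delta ` A)"
    by (intro fun_space.span_sum fun_space.span_scale fun_space.span_base) blast
  finally show "c \<in> fun_space.span (delta ` A)" .
qed

lemma dim_support:
  assumes "finite A"
  shows "fun_space.dim {c :: 'b \<Rightarrow> 'k::field. \<forall>x. c x \<noteq> 0 \<longrightarrow> x \<in> A} = card A"
proof (rule fun_space.dim_unique[OF _ support_span[OF assms]])
  have inj: "inj_on (delta :: 'b \<Rightarrow> 'b \<Rightarrow> 'k) A"
    by (rule inj_onI) (metis delta_def zero_neq_one)
  show "card ((delta :: 'b \<Rightarrow> 'b \<Rightarrow> 'k) ` A) = card A" using inj by (rule card_image)
  show "delta ` A \<subseteq> {c :: 'b \<Rightarrow> 'k. \<forall>x. c x \<noteq> 0 \<longrightarrow> x \<in> A}"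
    by (auto simp: delta_def split: if_splits)
  show "fun_space.independent ((delta :: 'b \<Rightarrow> 'b \<Rightarrow> 'k) ` A)"
  proof (rule fun_space.independent_if_scalars_zero)
    show "finite ((delta :: 'b \<Rightarrow> 'b \<Rightarrow> 'k) ` A)" using assms by simp
    fix g :: "('b \<Rightarrow> 'k) \<Rightarrow> 'k" and x :: "'b \<Rightarrow> 'k"
    assume 0: "(\<Sum>c\<in>delta ` A. (\<lambda>x. g c * c x)) = 0" and "x \<in> delta ` A"
    then obtain a where a: "x = delta a" "a \<in> A" by blast
    have "0 = (\<Sum>c\<in>delta ` A. (\<lambda>x. g c * c x)) a" using 0 by simp
    also have "\<dots> = (\<Sum>b\<in>A. g (delta b) * delta b a)"
      unfolding sum_fun_apply by (subst sum.reindex[OF inj]) simp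
    also have "\<dots> = (\<Sum>b\<in>A. if b = a then g (delta a) else 0)"
      by (rule sum.cong) (auto simp: delta_def)
    also have "\<dots> = g x" using a assms by simp
    finally show "g x = 0" by simp
  qed
qed

section \<open>Dimensions in the simplicial chain complex\<close>

lemma chains_eq: "chains i \<Delta> = {c. \<forall>\<sigma>. c \<sigma> \<noteq> 0 \<longrightarrow> \<sigma> \<in> {\<sigma> \<in> \<Delta>. int (card \<sigma>) = i + 1}}"
  by (simp add: chains_def)

lemma boundary_add: "boundary \<Delta> (x + y) = boundary \<Delta> x + boundary \<Delta> y"
proof
  fix \<tau>
  have e: "(if P then s * (x + y) \<sigma> else 0) = (if P then s * x \<sigma> else 0) + (if P then s * y \<sigma> else 0)"
    for P s \<sigma>
    by (simp add: algebra_simps)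
  show "boundary \<Delta> (x + y) \<tau> = (boundary \<Delta> x + boundary \<Delta> y) \<tau>"
    unfolding boundary_def e sum.distrib by simp
qed

lemma boundary_scale: "boundary \<Delta> (\<lambda>\<sigma>. a * x \<sigma>) = (\<lambda>\<tau>. a * boundary \<Delta> x \<tau>)"
proof
  fix \<tau>
  have e: "(if P then s * (a * x \<sigma>) else 0) = a * (if P then s * x \<sigma> else 0)" for P s \<sigma>
    by (simp add: algebra_simps)
  show "boundary \<Delta> (\<lambda>\<sigma>. a * x \<sigma>) \<tau> = a * boundary \<Delta> x \<tau>"
    unfolding boundary_def e sum_distrib_left ..
qed

lemma linear_boundary:
  "Vector_Spaces.linear (\<lambda>(a::'k::field) (c::'a set \<Rightarrow> 'k) x. a * c x) (\<lambda>a c x. a * c x) (boundary \<Delta>)"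
  unfolding Vector_Spaces.linear_iff using boundary_add boundary_scale fun_space.vector_space_axioms by auto

lemma subspace_chains: "fun_space.subspace (chains i \<Delta> :: ('a set \<Rightarrow> 'k::field) set)"
proof (rule fun_space.subspaceI)
  fix x y :: "'a set \<Rightarrow> 'k" assume xy: "x \<in> chains i \<Delta>" "y \<in> chains i \<Delta>"
  have "x \<sigma> \<noteq> 0 \<or> y \<sigma> \<noteq> 0" if "(x + y) \<sigma> \<noteq> 0" for \<sigma> using that by auto
  with xy show "x + y \<in> chains i \<Delta>" unfolding chains_def by blast
qed (auto simp: chains_def)

lemma dim_chains:
  assumes "finite \<Delta>"
  shows "fun_space.dim (chains (int j - 1) \<Delta> :: ('a set \<Rightarrow> 'k::field) set) = f_number \<Delta> j"
  unfolding chains_eq f_number_def using assms by (subst dim_support) auto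

text \<open>Rank and nullity for \<open>boundary\<close> on chains of faces of size
  \<open>j\<close>. Such faces have degree \<open>j - 1\<close> and their boundaries degree
  \<open>j - 2\<close>, whence the index shifts.\<close>

lemma f_number_eq_dims:
  assumes "finite \<Delta>"
  shows "f_number \<Delta> j = fun_space.dim (cycles (int j - 1) \<Delta> :: ('a set \<Rightarrow> 'k::field) set)
    + fun_space.dim (boundaries (int j - 2) \<Delta> :: ('a set \<Rightarrow> 'k) set)"
proof -
  interpret Vector_Spaces.linear "\<lambda>(a::'k) (c::'a set \<Rightarrow> 'k) x. a * c x" "\<lambda>a c x. a * c x" "boundary \<Delta>"
    by (rule linear_boundary)
  let ?C = "chains (int j - 1) \<Delta> :: ('a set \<Rightarrow> 'k) set"
  have "fun_space.dim ?C = fun_space.dim {x \<in> ?C. boundary \<Delta> x = 0} + fun_space.dim (boundary \<Delta> ` ?C)"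
  proof (rule dim_kernel_image[OF subspace_chains])
    show "?C \<subseteq> fun_space.span (delta ` {\<sigma> \<in> \<Delta>. int (card \<sigma>) = int j - 1 + 1})"
      unfolding chains_eq by (rule support_span) (use assms in simp)
  qed (use assms in simp)
  moreover have "int j - 2 + 1 = int j - 1" by simp
  ultimately show ?thesis
    using dim_chains[OF assms, of j, where 'k = 'k]
    by (simp only: cycles_def boundaries_def zero_fun_def)
qed

text \<open>The double sum is regrouped around the target: only the pairs
  \<open>(insert v \<tau>, v)\<close> with \<open>v\<close> outside \<open>\<tau>\<close>
  contribute.\<close>

lemma boundary_face:
  assumes sc: "simplicial_complex \<Delta>"
  shows "boundary \<Delta> c \<tau> = (\<Sum>v | v \<notin> \<tau> \<and> insert v \<tau> \<in> \<Delta>. (- 1) ^ vertex_position (insert v \<tau>) v * c (insert v \<tau>))"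
proof -
  have fin: "finite \<Delta>" and fin': "\<And>\<sigma>. \<sigma> \<in> \<Delta> \<Longrightarrow> finite \<sigma>"
    using sc by (auto simp: simplicial_complex_def)
  let ?g = "\<lambda>(\<sigma>, v). (- 1) ^ vertex_position \<sigma> v * c \<sigma>"
  have "boundary \<Delta> c \<tau> = (\<Sum>p\<in>(SIGMA \<sigma>:\<Delta>. \<sigma>). if fst p - {snd p} = \<tau> then ?g p else 0)"
    unfolding boundary_def by (subst sum.Sigma[OF fin]) (use fin' in \<open>auto intro!: sum.cong\<close>)
  also have "\<dots> = sum ?g {p \<in> (SIGMA \<sigma>:\<Delta>. \<sigma>). fst p - {snd p} = \<tau>}"
    using fin fin' by (subst sum.inter_filter) auto
  also have "\<dots> = (\<Sum>v | v \<notin> \<tau> \<and> insert v \<tau> \<in> \<Delta>. ?g (insert v \<tau>, v))"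
    by (rule sum.reindex_bij_witness[where i = "\<lambda>v. (insert v \<tau>, v)" and j = snd])
      (auto simp: insert_absorb)
  finally show ?thesis by simp
qed

text \<open>Adding a smaller vertex raises a position by one and adding a larger one leaves it
  unchanged. This asymmetry produces the opposite signs in \<open>boundary_boundary\<close>.\<close>

lemma vertex_position_insert:
  assumes "finite \<rho>" "v \<notin> \<rho>" "w \<notin> \<rho>" "v \<noteq> w" "(v, w) \<in> vertex_order"
  shows "vertex_position (insert w (insert v \<rho>)) w = Suc (vertex_position (insert w \<rho>) w)"
    "vertex_position (insert w (insert v \<rho>)) v = vertex_position (insert v \<rho>) v"
proof -
  have "(w, v) \<notin> vertex_order"
    using linear_order_vertex_order assms
    by (auto simp: linear_order_on_def partial_order_on_def antisym_def)
  then have "{x \<in> insert w (insert v \<rho>). x \<noteq> v \<and> (x, v) \<in> vertex_order}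
      = {x \<in> insert v \<rho>. x \<noteq> v \<and> (x, v) \<in> vertex_order}" by auto
  then show "vertex_position (insert w (insert v \<rho>)) v = vertex_position (insert v \<rho>) v"
    by (simp add: vertex_position_def)
  have "{x \<in> insert w (insert v \<rho>). x \<noteq> w \<and> (x, w) \<in> vertex_order}
      = insert v {x \<in> insert w \<rho>. x \<noteq> w \<and> (x, w) \<in> vertex_order}" using assms by auto
  then show "vertex_position (insert w (insert v \<rho>)) w = Suc (vertex_position (insert w \<rho>) w)"
    using assms by (simp add: vertex_position_def)
qed

text \<open>Two vertices can be removed in two orders. Splitting the ordered pairs by
  \<open>vertex_order\<close> into \<open>?L\<close> and \<open>?G\<close>, the swap matches terms
  of opposite sign.\<close>

lemma boundary_boundary:
  assumes sc: "simplicial_complex \<Delta>"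
  shows "boundary \<Delta> (boundary \<Delta> c) = (\<lambda>_. 0)"
proof
  fix \<rho>
  have fin: "finite \<Delta>" and fin': "\<And>\<sigma>. \<sigma> \<in> \<Delta> \<Longrightarrow> finite \<sigma>"
    and sub: "\<And>\<sigma> \<tau>. \<sigma> \<in> \<Delta> \<Longrightarrow> \<tau> \<subseteq> \<sigma> \<Longrightarrow> \<tau> \<in> \<Delta>"
    using sc by (auto simp: simplicial_complex_def)
  have finV: "finite {v. v \<notin> \<tau> \<and> insert v \<tau> \<in> \<Delta>}" for \<tau>
    by (rule finite_subset[of _ "\<Union>\<Delta>"]) (use fin fin' in auto)
  define g where "g = (\<lambda>(v, w). (- 1) ^ vertex_position (insert v \<rho>) v *
    ((- 1) ^ vertex_position (insert w (insert v \<rho>)) w * c (insert w (insert v \<rho>))))"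
  define A where "A = {(v, w). v \<notin> \<rho> \<and> w \<notin> \<rho> \<and> v \<noteq> w \<and> insert w (insert v \<rho>) \<in> \<Delta>}"
  have finA: "finite A"
    by (rule finite_subset[of _ "\<Union>\<Delta> \<times> \<Union>\<Delta>"]) (use fin fin' in \<open>auto simp: A_def\<close>)
  let ?L = "{(v, w) \<in> A. (v, w) \<in> vertex_order}" and ?G = "{(v, w) \<in> A. (w, v) \<in> vertex_order}"
  have total: "(v, w) \<in> vertex_order \<or> (w, v) \<in> vertex_order" if "v \<noteq> w" for v w
    using linear_order_vertex_order that by (auto simp: linear_order_on_def total_on_def)
  have asym: "(w, v) \<notin> vertex_order" if "(v, w) \<in> vertex_order" "v \<noteq> w" for v w
    using linear_order_vertex_order that
    by (auto simp: linear_order_on_def partial_order_on_def antisym_def)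
  have "boundary \<Delta> (boundary \<Delta> c) \<rho>
      = (\<Sum>v | v \<notin> \<rho> \<and> insert v \<rho> \<in> \<Delta>. \<Sum>w | w \<notin> insert v \<rho> \<and> insert w (insert v \<rho>) \<in> \<Delta>. g (v, w))"
    by (simp add: boundary_face[OF sc] sum_distrib_left g_def)
  also have "\<dots> = sum g (SIGMA v:{v. v \<notin> \<rho> \<and> insert v \<rho> \<in> \<Delta>}. {w. w \<notin> insert v \<rho> \<and> insert w (insert v \<rho>) \<in> \<Delta>})"
    by (subst sum.Sigma) (simp_all add: finV case_prod_eta del: insert_iff)
  also have "(SIGMA v:{v. v \<notin> \<rho> \<and> insert v \<rho> \<in> \<Delta>}. {w. w \<notin> insert v \<rho> \<and> insert w (insert v \<rho>) \<in> \<Delta>}) = A"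
    using sub by (auto simp: A_def)
  also have "A = ?L \<union> ?G" unfolding A_def by (auto dest: total)
  also have "sum g (?L \<union> ?G) = sum g ?L + sum g ?G"
    by (rule sum.union_disjoint) (auto simp: A_def dest: asym intro: finite_subset[OF _ finA])
  also have "sum g ?G = (\<Sum>p\<in>?L. - g p)"
  proof (rule sum.reindex_bij_witness[where i = prod.swap and j = prod.swap])
    fix p assume "p \<in> ?G"
    then obtain v w where p: "p = (v, w)" "(v, w) \<in> A" "(w, v) \<in> vertex_order" by auto
    then have A: "v \<notin> \<rho>" "w \<notin> \<rho>" "v \<noteq> w" "insert w (insert v \<rho>) \<in> \<Delta>" by (auto simp: A_def)
    then have "finite \<rho>" using fin' by fastforce
    from vertex_position_insert[OF this A(2,1) A(3)[symmetric] p(3)]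
    show "- g (prod.swap p) = g p"
      by (simp add: p(1) g_def insert_commute)
  qed (auto simp: A_def insert_commute)
  finally show "boundary \<Delta> (boundary \<Delta> c) \<rho> = 0"
    by (simp only: sum_negf add.right_inverse)
qed

lemma boundary_chains:
  assumes sc: "simplicial_complex \<Delta>" and c: "c \<in> chains (i + 1) \<Delta>"
  shows "boundary \<Delta> c \<in> chains i \<Delta>"
  unfolding chains_def
proof (intro CollectI allI impI)
  fix \<tau> assume "boundary \<Delta> c \<tau> \<noteq> 0"
  then obtain v where v: "v \<notin> \<tau>" "insert v \<tau> \<in> \<Delta>" "c (insert v \<tau>) \<noteq> 0"
    unfolding boundary_face[OF sc] by (auto elim!: sum.not_neutral_contains_not_neutral)
  then have "finite \<tau>" "\<tau> \<in> \<Delta>" using sc by (auto simp: simplicial_complex_def)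
  moreover have "int (card (insert v \<tau>)) = i + 1 + 1" using c v by (auto simp: chains_def)
  ultimately show "\<tau> \<in> \<Delta> \<and> int (card \<tau>) = i + 1" using v by simp
qed

lemma boundaries_subset_cycles: "simplicial_complex \<Delta> \<Longrightarrow> boundaries i \<Delta> \<subseteq> cycles i \<Delta>"
  using boundary_chains boundary_boundary by (auto simp: boundaries_def cycles_def)

lemma boundary_zero: "boundary \<Delta> (\<lambda>_. 0) = (\<lambda>_. 0)"
  by (simp add: boundary_def cong: if_cong)

lemma zero_cycle: "(\<lambda>_. 0) \<in> cycles i \<Delta>"
  by (simp add: cycles_def chains_def boundary_zero)

lemma zero_boundary: "(\<lambda>_. 0) \<in> boundaries i \<Delta>"
proof -
  have "boundary \<Delta> (\<lambda>_. 0) \<in> boundary \<Delta> ` chains (i + 1) \<Delta>"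
    by (rule imageI) (simp add: chains_def)
  then show ?thesis by (simp only: boundaries_def boundary_zero)
qed

section \<open>From homology to Euler characteristics\<close>

lemma homology_vanishes_eq:
  assumes sc: "simplicial_complex \<Delta>" and van: "homology_vanishes TYPE('k::field) i \<Delta>"
  shows "cycles i \<Delta> = (boundaries i \<Delta> :: ('a set \<Rightarrow> 'k) set)"
proof
  show "boundaries i \<Delta> \<subseteq> (cycles i \<Delta> :: ('a set \<Rightarrow> 'k) set)"
    by (rule boundaries_subset_cycles[OF sc])
  show "cycles i \<Delta> \<subseteq> (boundaries i \<Delta> :: ('a set \<Rightarrow> 'k) set)"
  proof
    fix x :: "'a set \<Rightarrow> 'k" assume x: "x \<in> cycles i \<Delta>"
    let ?z = "\<lambda>_. 0 :: 'k"
    have "homology_class i \<Delta> x \<in> reduced_homology i \<Delta>" "homology_class i \<Delta> ?z \<in> reduced_homology i \<Delta>"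
      unfolding reduced_homology_def using x zero_cycle by (auto intro: quotientI)
    then have "homology_class i \<Delta> x = homology_class i \<Delta> ?z"
      using van unfolding homology_vanishes_def is_singleton_def by fastforce
    moreover have "?z \<in> homology_class i \<Delta> ?z"
      using zero_cycle zero_boundary by (auto simp: homologous_def)
    ultimately have "?z \<in> homology_class i \<Delta> x" by simp
    then show "x \<in> boundaries i \<Delta>" by (simp add: homologous_def)
  qed
qed

text \<open>Without nonzero boundaries every homology class is a singleton, so the isomorphism acts
  on cycles themselves; the cycle sent to 1 spans them all.\<close>

lemma dim_top_cycles:
  assumes iso: "homology_iso_field TYPE('k::field) i \<Delta>"
    and top: "boundaries i \<Delta> = {\<lambda>_. 0 :: 'k}"
  shows "fun_space.dim (cycles i \<Delta> :: ('a set \<Rightarrow> 'k) set) = 1"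
proof -
  let ?Z = "cycles i \<Delta> :: ('a set \<Rightarrow> 'k) set"
  obtain \<phi> :: "('a set \<Rightarrow> 'k) set \<Rightarrow> 'k" where bij: "bij_betw \<phi> (reduced_homology i \<Delta>) UNIV"
    and scale: "\<And>a x. x \<in> ?Z \<Longrightarrow> \<phi> (homology_class i \<Delta> (\<lambda>\<sigma>. a * x \<sigma>)) = a * \<phi> (homology_class i \<Delta> x)"
    using iso unfolding homology_iso_field_def by blast
  have cls: "homology_class i \<Delta> x = {x}" if "x \<in> ?Z" for x
    using that by (auto simp: homologous_def top fun_eq_iff)
  have sc: "(\<lambda>\<sigma>. a * x \<sigma>) \<in> ?Z" if "x \<in> ?Z" for a x
    using that by (auto simp: cycles_def chains_def boundary_scale)
  have H: "reduced_homology i \<Delta> = (\<lambda>x. {x}) ` ?Z"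
    unfolding reduced_homology_def quotient_def using cls by auto
  obtain u where u: "u \<in> ?Z" "\<phi> {u} = 1"
  proof -
    have "1 \<in> \<phi> ` (\<lambda>x. {x}) ` ?Z" using bij unfolding H bij_betw_def by simp
    then show thesis using that by auto
  qed
  have inj: "x = y" if "x \<in> ?Z" "y \<in> ?Z" "\<phi> {x} = \<phi> {y}" for x y
    using bij that unfolding H bij_betw_def inj_on_def by blast
  have span: "x \<in> fun_space.span {u}" if x: "x \<in> ?Z" for x
  proof -
    have "\<phi> {\<lambda>\<sigma>. \<phi> {x} * u \<sigma>} = \<phi> {x}"
      using scale[OF u(1), of "\<phi> {x}"] u cls sc by simp
    then have "(\<lambda>\<sigma>. \<phi> {x} * u \<sigma>) = x" using inj sc u(1) x by blast
    then show ?thesis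
      using fun_space.span_scale[OF fun_space.span_base, of u "{u}" "\<phi> {x}"] by simp
  qed
  have "u \<noteq> 0"
  proof
    assume "u = 0"
    then have "(\<lambda>\<sigma>. 0 * u \<sigma>) = u" by (simp add: fun_eq_iff)
    then show False using scale[OF u(1), of 0] u cls by simp
  qed
  then have "fun_space.independent {u}" by simp
  then show ?thesis using u span by (intro fun_space.dim_unique[of "{u}"]) auto
qed

text \<open>The Euler--Poincare argument: \<open>f_number \<Gamma> j = z j + b j\<close> and
  \<open>z j = b (Suc j)\<close> below the top, so the alternating sum telescopes to the top cycles,
  which have dimension 1.\<close>

theorem reduced_euler_characteristic:
  assumes sc: "simplicial_complex \<Gamma>" and card: "\<And>\<sigma>. \<sigma> \<in> \<Gamma> \<Longrightarrow> card \<sigma> \<le> D"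
    and van: "\<And>i. i < int D - 1 \<Longrightarrow> homology_vanishes TYPE('k::field) i \<Gamma>"
    and iso: "homology_iso_field TYPE('k) (int D - 1) \<Gamma>"
  shows "(\<Sum>\<sigma>\<in>\<Gamma>. (- 1) ^ card \<sigma>) = ((- 1) ^ D :: int)"
proof -
  have fin: "finite \<Gamma>" using sc by (simp add: simplicial_complex_def)
  \<comment> \<open>The index is the cardinality \<open>j\<close> of faces: \<open>z j\<close>
    measures the cycles among their chains and \<open>b j\<close> the image of these chains under
    \<open>boundary\<close>.\<close>
  define z b where "z = (\<lambda>j. fun_space.dim (cycles (int j - 1) \<Gamma> :: ('a set \<Rightarrow> 'k) set))"
    and "b = (\<lambda>j. fun_space.dim (boundaries (int j - 2) \<Gamma> :: ('a set \<Rightarrow> 'k) set))"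
  have f: "f_number \<Gamma> j = z j + b j" for j
    using f_number_eq_dims[OF fin] by (simp add: z_def b_def)
  have zb: "z j = b (Suc j)" if "j < D" for j
  proof -
    have "int j - 1 = int (Suc j) - 2" by simp
    then show ?thesis
      using homology_vanishes_eq[OF sc van, of "int j - 1"] that by (simp add: z_def b_def)
  qed
  \<comment> \<open>No face has \<open>D + 1\<close> elements, so there is nothing to take the
    boundary of.\<close>
  have top: "boundaries (int D - 1) \<Gamma> = {\<lambda>_. 0 :: 'k}"
  proof -
    have "c = (\<lambda>_. 0)" if "c \<in> chains (int D - 1 + 1) \<Gamma>" for c :: "'a set \<Rightarrow> 'k"
    proof
      fix \<sigma> show "c \<sigma> = 0" using that card[of \<sigma>] unfolding chains_def by fastforce
    qed
    moreover have "(\<lambda>_. 0) \<in> chains (int D - 1 + 1) \<Gamma>" by (simp add: chains_def)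
    ultimately have "chains (int D - 1 + 1) \<Gamma> = {\<lambda>_. 0 :: 'k}" by blast
    then show ?thesis by (simp add: boundaries_def boundary_zero)
  qed
  have zD: "z D = 1" unfolding z_def by (rule dim_top_cycles[OF iso top])
  \<comment> \<open>Boundaries of the augmentation degree would lie in degree -2, which contains
    only the zero chain.\<close>
  have b0: "b 0 = 0"
  proof -
    have "chains (-2) \<Gamma> \<subseteq> {\<lambda>_. 0 :: 'k}"
    proof
      fix c :: "'a set \<Rightarrow> 'k" assume "c \<in> chains (-2) \<Gamma>"
      then have "c \<sigma> = 0" for \<sigma> unfolding chains_def by fastforce
      then show "c \<in> {\<lambda>_. 0}" by auto
    qed
    moreover have "boundaries (-2) \<Gamma> \<subseteq> (chains (-2) \<Gamma> :: ('a set \<Rightarrow> 'k) set)"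
      using boundary_chains[OF sc, of _ "-2"] by (auto simp: boundaries_def)
    ultimately have "boundaries (int 0 - 2) \<Gamma> \<subseteq> {\<lambda>_. 0 :: 'k}" by simp
    then have "boundaries (int 0 - 2) \<Gamma> \<subseteq> fun_space.span ({} :: ('a set \<Rightarrow> 'k) set)"
      by (auto simp: zero_fun_def)
    from fun_space.dim_le_card[OF this] show ?thesis by (simp add: b_def)
  qed
  have tele: "(\<Sum>j=0..n. (- 1) ^ j * int (z j + b j)) = (- 1) ^ n * int (z n)" if "n \<le> D" for n
    using that
  proof (induction n)
    case 0
    then show ?case using b0 by simp
  next
    case (Suc n)
    then show ?case using zb[of n] by (simp add: algebra_simps)
  qed
  have "(\<Sum>\<sigma>\<in>\<Gamma>. (- 1) ^ card \<sigma>) = (\<Sum>j=0..D. \<Sum>\<sigma> | \<sigma> \<in> \<Gamma> \<and> card \<sigma> = j. (- 1 :: int) ^ card \<sigma>)"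
    by (rule sum.group[symmetric]) (use fin card in auto)
  also have "\<dots> = (\<Sum>j=0..D. (- 1) ^ j * int (f_number \<Gamma> j))"
    by (rule sum.cong) (auto simp: f_number_def)
  also have "\<dots> = (- 1) ^ D" using tele[of D] zD by (simp add: f)
  finally show ?thesis .
qed

lemma face_in_facet:
  assumes sc: "simplicial_complex \<Delta>" and s: "\<sigma> \<in> \<Delta>"
  obtains \<tau> where "\<tau> \<in> facets \<Delta>" "\<sigma> \<subseteq> \<tau>"
proof -
  have "finite \<Delta>" using sc by (simp add: simplicial_complex_def)
  from finite_has_maximal2[OF this s] obtain \<tau>
    where t: "\<tau> \<in> \<Delta>" "\<sigma> \<subseteq> \<tau>" "\<forall>\<rho>\<in>\<Delta>. \<tau> \<subseteq> \<rho> \<longrightarrow> \<tau> = \<rho>"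
    by blast
  then have "\<tau> \<in> facets \<Delta>" by (auto simp: facets_def)
  with that t(2) show thesis by blast
qed

theorem homology_sphere_eulerian:
  assumes "homology_sphere TYPE('k::field) d \<Delta>"
  shows "eulerian_complex d \<Delta>"
proof -
  have sc: "simplicial_complex \<Delta>" and pure: "pure_complex d \<Delta>"
    and van: "\<And>f i. f \<in> \<Delta> \<Longrightarrow> i < int d - 1 - int (card f) \<Longrightarrow> homology_vanishes TYPE('k) i (link \<Delta> f)"
    and iso: "\<And>f. f \<in> \<Delta> \<Longrightarrow> homology_iso_field TYPE('k) (int d - 1 - int (card f)) (link \<Delta> f)"
    using assms by (auto simp: homology_sphere_def)
  have fin': "\<And>\<sigma>. \<sigma> \<in> \<Delta> \<Longrightarrow> finite \<sigma>" using sc by (auto simp: simplicial_complex_def)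
  have card: "card \<sigma> \<le> d" if s: "\<sigma> \<in> \<Delta>" for \<sigma>
  proof -
    obtain \<tau> where t: "\<tau> \<in> facets \<Delta>" "\<sigma> \<subseteq> \<tau>" using face_in_facet[OF sc s] .
    then have "card \<tau> = d" "finite \<tau>" using pure fin' by (auto simp: pure_complex_def facets_def)
    with t(2) show ?thesis using card_mono by metis
  qed
  have "(\<Sum>\<tau>\<in>link \<Delta> \<sigma>. (- 1) ^ card \<tau>) = ((- 1) ^ (d - card \<sigma>) :: int)" if s: "\<sigma> \<in> \<Delta>" for \<sigma>
  proof (rule reduced_euler_characteristic)
    \<comment> \<open>The natural subtraction is exact because faces have at most \<open>d\<close>
      elements.\<close>
    have i: "int (d - card \<sigma>) - 1 = int d - 1 - int (card \<sigma>)" using card[OF s] by simp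
    show "homology_vanishes TYPE('k) i (link \<Delta> \<sigma>)" if "i < int (d - card \<sigma>) - 1" for i
      using that van[OF s] unfolding i by blast
    show "homology_iso_field TYPE('k) (int (d - card \<sigma>) - 1) (link \<Delta> \<sigma>)"
      using iso[OF s] unfolding i .
    show "simplicial_complex (link \<Delta> \<sigma>)"
      using sc s unfolding simplicial_complex_def link_def by (auto intro: finite_subset) (meson Un_mono order_refl)
    show "card \<tau> \<le> d - card \<sigma>" if "\<tau> \<in> link \<Delta> \<sigma>" for \<tau>
    proof -
      have "card (\<tau> \<union> \<sigma>) = card \<tau> + card \<sigma>"
        using that s fin' by (intro card_Un_disjoint) (auto simp: link_def)
      moreover have "card (\<tau> \<union> \<sigma>) \<le> d" using that by (intro card) (simp add: link_def)
      ultimately show ?thesis by simp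
    qed
  qed
  with sc card show ?thesis by (simp add: eulerian_complex_def)
qed

section \<open>Flag homology spheres\<close>

text \<open>The clause \<open>x \<noteq> y\<close> ensures irreflexivity on the whole type, also
  where the singleton of \<open>x\<close> is not a face.\<close>

definition nonadjacent :: "'a set set \<Rightarrow> 'a \<Rightarrow> 'a \<Rightarrow> bool" where
  "nonadjacent \<Delta> x y \<longleftrightarrow> x \<noteq> y \<and> {x, y} \<notin> \<Delta>"

lemma incompatibility_nonadjacent: "incompatibility (nonadjacent \<Delta>)"
  by unfold_locales (auto simp: nonadjacent_def insert_commute)

text \<open>An independent set that is not a face contains a minimal non-face. Flagness gives it two
  elements, which then form a non-adjacent pair.\<close>

lemma flag_eq_independent_sets:
  assumes sc: "simplicial_complex \<Delta>" and flag: "flag_complex \<Delta>"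
  shows "\<Delta> = independent_sets (nonadjacent \<Delta>) (vertices \<Delta>)"
proof (intro equalityI subsetI)
  fix \<sigma> assume s: "\<sigma> \<in> \<Delta>"
  have "{x, y} \<in> \<Delta>" if "x \<in> \<sigma>" "y \<in> \<sigma>" for x y
    using sc s that by (auto simp: simplicial_complex_def)
  with s show "\<sigma> \<in> independent_sets (nonadjacent \<Delta>) (vertices \<Delta>)"
    by (auto simp: independent_sets_def nonadjacent_def vertices_def)
next
  fix \<sigma> assume s: "\<sigma> \<in> independent_sets (nonadjacent \<Delta>) (vertices \<Delta>)"
  have "finite (vertices \<Delta>)" using sc by (auto simp: simplicial_complex_def vertices_def)
  then have "finite \<sigma>" using s by (auto simp: independent_sets_def intro: finite_subset)
  then have fin: "finite {\<tau> \<in> Pow \<sigma>. \<tau> \<notin> \<Delta>}" by simp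
  show "\<sigma> \<in> \<Delta>"
  proof (rule ccontr)
    assume "\<sigma> \<notin> \<Delta>"
    then have "\<sigma> \<in> {\<tau> \<in> Pow \<sigma>. \<tau> \<notin> \<Delta>}" by simp
    from finite_has_minimal2[OF fin this] obtain \<tau> where t: "\<tau> \<subseteq> \<sigma>" "\<tau> \<notin> \<Delta>"
      and min: "\<forall>\<rho>\<in>{\<tau> \<in> Pow \<sigma>. \<tau> \<notin> \<Delta>}. \<rho> \<subseteq> \<tau> \<longrightarrow> \<tau> = \<rho>" by blast
    have "minimal_nonface \<Delta> \<tau>"
      unfolding minimal_nonface_def
    proof (intro conjI allI impI)
      show "\<tau> \<subseteq> vertices \<Delta>" using t s by (auto simp: independent_sets_def)
      show "\<rho> \<in> \<Delta>" if "\<rho> \<subset> \<tau>" for \<rho>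
      proof (rule ccontr)
        assume "\<rho> \<notin> \<Delta>"
        then have "\<rho> \<in> {\<tau> \<in> Pow \<sigma>. \<tau> \<notin> \<Delta>}" using that t by blast
        with min that show False by blast
      qed
    qed (rule t)
    then have "card \<tau> = 2" using flag by (simp add: flag_complex_def)
    then obtain x y where "\<tau> = {x, y}" "x \<noteq> y" by (auto simp: card_2_iff)
    then show False using t s by (auto simp: independent_sets_def nonadjacent_def)
  qed
qed

text \<open>The link of a ridge consists of the empty face and points, so its signed count is 1
  minus the number of points; the Euler condition makes this -1.\<close>

lemma ridge_in_two_facets:
  assumes eu: "eulerian_complex d \<Delta>" and s: "\<sigma> \<in> \<Delta>" "card \<sigma> + 1 = d"
  shows "card {x \<in> vertices \<Delta> - \<sigma>. insert x \<sigma> \<in> \<Delta>} = 2"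
proof -
  let ?X = "{x \<in> vertices \<Delta> - \<sigma>. insert x \<sigma> \<in> \<Delta>}"
  have sc: "simplicial_complex \<Delta>" using eu by (simp add: eulerian_complex_def)
  have fin': "\<And>\<tau>. \<tau> \<in> \<Delta> \<Longrightarrow> finite \<tau>" and sub: "\<And>\<tau> \<rho>. \<tau> \<in> \<Delta> \<Longrightarrow> \<rho> \<subseteq> \<tau> \<Longrightarrow> \<rho> \<in> \<Delta>"
    using sc by (auto simp: simplicial_complex_def)
  have "finite (vertices \<Delta>)" using sc by (auto simp: simplicial_complex_def vertices_def)
  then have finX: "finite ?X" by simp
  have link: "link \<Delta> \<sigma> = insert {} ((\<lambda>x. {x}) ` ?X)"
  proof (intro equalityI subsetI)
    fix \<tau> assume t: "\<tau> \<in> link \<Delta> \<sigma>"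
    then have "card (\<tau> \<union> \<sigma>) = card \<tau> + card \<sigma>"
      using s fin' by (intro card_Un_disjoint) (auto simp: link_def)
    moreover have "card (\<tau> \<union> \<sigma>) \<le> d" using t eu by (auto simp: link_def eulerian_complex_def)
    ultimately have "card \<tau> \<le> 1" using s by simp
    moreover have "finite \<tau>" using t fin' by (auto simp: link_def)
    ultimately consider "\<tau> = {}" | x where "\<tau> = {x}"
      by (auto simp: le_Suc_eq card_1_singleton_iff)
    then show "\<tau> \<in> insert {} ((\<lambda>x. {x}) ` ?X)"
      using t by cases (auto simp: link_def vertices_def)
  next
    fix \<tau> assume "\<tau> \<in> insert {} ((\<lambda>x. {x}) ` ?X)"
    then consider "\<tau> = {}" | x where "\<tau> = {x}" "x \<notin> \<sigma>" "insert x \<sigma> \<in> \<Delta>" by blast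
    then show "\<tau> \<in> link \<Delta> \<sigma>"
      using s sub by cases (auto simp: link_def)
  qed
  have "- 1 = (\<Sum>\<tau>\<in>link \<Delta> \<sigma>. (- 1 :: int) ^ card \<tau>)"
    using eu s by (auto simp: eulerian_complex_def)
  also have "\<dots> = 1 + (\<Sum>\<tau>\<in>(\<lambda>x. {x}) ` ?X. (- 1 :: int) ^ card \<tau>)"
    unfolding link by (subst sum.insert) (use finX in auto)
  also have "(\<Sum>\<tau>\<in>(\<lambda>x. {x}) ` ?X. (- 1 :: int) ^ card \<tau>) = - int (card ?X)"
    by (subst sum.reindex) auto
  finally show ?thesis by simp
qed

lemma f_number_1: "simplicial_complex \<Delta> \<Longrightarrow> f_number \<Delta> 1 = card (vertices \<Delta>)"
proof -
  assume "simplicial_complex \<Delta>"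
  then have "{\<sigma> \<in> \<Delta>. card \<sigma> = 1} = (\<lambda>x. {x}) ` vertices \<Delta>"
    by (auto simp: simplicial_complex_def vertices_def card_1_singleton_iff)
  then show ?thesis unfolding f_number_def by (simp add: card_image)
qed

theorem theorem3p7:
  fixes \<Delta> :: "'a set set" and d l :: nat
  assumes "homology_sphere TYPE('k::field) d \<Delta>"
    and "flag_complex \<Delta>"
    and "card (vertices \<Delta>) = 2 * d + l"
  shows "gamma_vector d \<Delta> 2 \<le> int (l choose 2) \<and>
    (gamma_vector d \<Delta> 2 = int (l choose 2) \<longleftrightarrow>
      (\<exists>m. complex_iso \<Delta> (iterated_suspension m (iterated_join l cycle5))))"
proof -
  have sc: "simplicial_complex \<Delta>" and pure: "pure_complex d \<Delta>"
    using assms(1) by (auto simp: homology_sphere_def)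
  have eu: "eulerian_complex d \<Delta>" by (rule homology_sphere_eulerian[OF assms(1)])
  interpret incompatibility "nonadjacent \<Delta>" by (rule incompatibility_nonadjacent)
  let ?V = "vertices \<Delta>"
  have \<Delta>: "indep ?V = \<Delta>" using flag_eq_independent_sets[OF sc assms(2)] by simp
  have finV: "finite ?V" using sc by (auto simp: simplicial_complex_def vertices_def)
  have pm: "pseudomanifold d ?V"
    unfolding pseudomanifold_def \<Delta>
  proof (intro conjI ballI impI)
    fix \<sigma> assume s: "\<sigma> \<in> \<Delta>"
    obtain \<tau> where "\<tau> \<in> facets \<Delta>" "\<sigma> \<subseteq> \<tau>" using face_in_facet[OF sc s] .
    then show "\<exists>\<tau>\<in>\<Delta>. \<sigma> \<subseteq> \<tau> \<and> card \<tau> = d"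
      using pure by (auto simp: pure_complex_def facets_def)
    show "card \<sigma> \<le> d" using eu s by (simp add: eulerian_complex_def)
    show "card {x \<in> ?V - \<sigma>. insert x \<sigma> \<in> \<Delta>} = 2" if "card \<sigma> + 1 = d"
      by (rule ridge_in_two_facets[OF eu s that])
  qed (rule finV)
  have "2 * f_number \<Delta> 2 + npairs ?V = card ?V * (card ?V - 1)"
    using f_number_2_indep[OF finV] unfolding \<Delta> .
  then have "int (2 * f_number \<Delta> 2 + npairs ?V) = int (card ?V * (card ?V - 1))" by (rule arg_cong)
  also have "\<dots> = int (card ?V) * (int (card ?V) - 1)" by (cases "card ?V") (simp_all add: algebra_simps)
  finally have f2: "2 * int (f_number \<Delta> 2) + int (npairs ?V) = (2 * int d + int l) * (2 * int d + int l - 1)"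
    using assms(3) by simp
  have "int (f_number \<Delta> 2) = 2 * int d * (int d - 1) + int l * (2 * int d - 3) + gamma_vector d \<Delta> 2"
    using f_number_2_gamma[OF eu] f_number_1[OF sc] assms(3) by simp
  moreover have "2 * int (l choose 2) = int l * (int l - 1)"
  proof -
    have "2 * (l choose 2) = l * (l - 1)"
      unfolding choose_two by (rule dvd_mult_div_cancel) (cases l; simp)
    then have "int (2 * (l choose 2)) = int (l * (l - 1))" by (rule arg_cong)
    also have "\<dots> = int l * (int l - 1)" by (cases l) (simp_all add: algebra_simps)
    finally show ?thesis by simp
  qed
  \<comment> \<open>On eliminating \<open>f_number \<Delta> 2\<close>, the gap in the bound for the
    gamma-vector, doubled, turns out to be exactly the gap in \<open>npairs_ge\<close>. Inequality
    and equality case therefore both transfer.\<close>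
  ultimately have key: "2 * int (l choose 2) - 2 * gamma_vector d \<Delta> 2
      = int (npairs ?V) + 10 * int d - 6 * int (card ?V)"
    using f2 assms(3) by (simp add: algebra_simps)
  moreover have "6 * int (card ?V) \<le> int (npairs ?V) + 10 * int d"
    using npairs_ge[OF pm] by linarith
  ultimately have "gamma_vector d \<Delta> 2 \<le> int (l choose 2)" by linarith
  moreover have "gamma_vector d \<Delta> 2 = int (l choose 2) \<longleftrightarrow> extremal d ?V"
    unfolding extremal_def using key pm by linarith
  ultimately show ?thesis
    using extremal_iff_iso[OF pm assms(3)] unfolding \<Delta> by blast
qed

end
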